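(* Let $X,Y\in L^\infty$ satisfy $K_a(X)>K_a(Y)$ for all $a\in\overline{\mathbb{R}}$. Then there exists a c.d.f. $H$ of a bounded random variable such that any $Z\in L^\infty$ with c.d.f. $H$ that is independent of $X$ and $Y$ satisfies $X+Z\ge_1Y+Z$. (Only the distributions of $X$ and $Y$ matter: the conclusion is that whenever $\hat X,\hat Y,Z$ are bounded random variables, with $\hat X$ distributed as $X$, $\hat Y$ distributed as $Y$, and $Z$ with c.d.f. $H$ independent of $\hat X$ and of $\hat Y$, then $\hat X+Z\ge_1\hat Y+Z$.)
   Context: $L^\infty$ is the set of bounded real random variables on a fixed nonatomic probability space; $\overline{\mathbb{R}}=\mathbb{R}\cup\{-\infty,\infty\}$. For $a\in\mathbb{R}\setminus\{0\}$, $K_a(X)=\frac1a\log\mathbb{E}[e^{aX}]$; $K_0(X)=\mathbb{E}[X]$; $K_\infty(X)$ and $K_{-\infty}(X)$ are the essential maximum and essential minimum of $X$. $X\ge_1Y$ denotes first-order stochastic dominance: $\mathbb{P}[X\le t]\le\mathbb{P}[Y\le t]$ for all $t\in\mathbb{R}$. *)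

theory Defs
  imports "HOL-Probability.Probability"
begin

definition nonatomic :: "'a measure \<Rightarrow> bool" where
  "nonatomic M \<longleftrightarrow>
     (\<forall>A\<in>sets M. 0 < emeasure M A \<longrightarrow>
        (\<exists>B\<in>sets M. B \<subseteq> A \<and> 0 < emeasure M B \<and> emeasure M B < emeasure M A))"

(* Boundedness is understood almost surely. *)
definition L_infty :: "'a measure \<Rightarrow> ('a \<Rightarrow> real) set" where
  "L_infty M = {X \<in> borel_measurable M. \<exists>c. AE \<omega> in M. \<bar>X \<omega>\<bar> \<le> c}"

definition ess_max :: "'a measure \<Rightarrow> ('a \<Rightarrow> real) \<Rightarrow> ereal" where
  "ess_max M X = esssup M (\<lambda>\<omega>. ereal (X \<omega>))"

definition ess_min :: "'a measure \<Rightarrow> ('a \<Rightarrow> real) \<Rightarrow> ereal" where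
  "ess_min M X = - esssup M (\<lambda>\<omega>. - ereal (X \<omega>))"

(* The values are real for bounded X; they are taken in ereal because esssup needs a
   complete linear order. *)
definition K :: "'a measure \<Rightarrow> ereal \<Rightarrow> ('a \<Rightarrow> real) \<Rightarrow> ereal" where
  "K M a X =
     (case a of
        ereal r \<Rightarrow>
          ereal (if r = 0 then integral\<^sup>L M X
                 else 1 / r * ln (integral\<^sup>L M (\<lambda>\<omega>. exp (r * X \<omega>))))
      | PInfty \<Rightarrow> ess_max M X
      | MInfty \<Rightarrow> ess_min M X)"

definition fosd :: "'a measure \<Rightarrow> ('a \<Rightarrow> real) \<Rightarrow> ('a \<Rightarrow> real) \<Rightarrow> bool" where
  "fosd M X Y \<longleftrightarrow>
     (\<forall>t. measure M {\<omega> \<in> space M. X \<omega> \<le> t} \<le> measure M {\<omega> \<in> space M. Y \<omega> \<le> t})"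

end

theory Submission
  imports Defs
begin

text \<open>
  Take $Z$ with density proportional to $g(z) = e^{-vz^2}$ on $[-A,A]$, where $v$ is small and $A$ is
  large. Let $J_k(x)$ be the integral of $k$ over $[-N,x]$, where $|X|, |Y| \le N$. Up to a
  normalising factor, $P[Y+Z \le s] - P[X+Z \le s] = E[J_k(X)] - E[J_k(Y)]$ with $k(u) = g(s-u)$.
  For $s \ge 0$ and $|u| \le N$ this kernel is, up to the factor $e^{-vs^2}$, equal to
  $e^{tu-vu^2}$ with $t = 2vs$, truncated to $u \ge s - A$.

  For large $t$ the truncated kernel gives so much more weight to the points above the essential
  maximum of $Y$ than to the points below it that the difference is nonnegative whatever the
  truncation. For bounded $t$ the truncation is not felt and the difference converges uniformly, as
  $v$ tends to $0$, to the difference for the kernel $e^{tu}$, which is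
  $(E[e^{tX}] - E[e^{tY}])/t$ and is bounded away from $0$ by continuity in $t$. Negative $s$
  reduces to positive $s$ by passing from $(X,Y)$ to $(-Y,-X)$.
\<close>

subsection \<open>Random variables on a nonatomic space\<close>

text \<open>The Gaussian is chosen because completing the square turns the shift by \<open>s\<close>
  into an exponential tilt with \<open>t = 2vs\<close>: a single \<open>Z\<close> tests all the
  \<open>K_a\<close> at once, and the leftover factor \<open>exp (- v u^2)\<close> is close to 1 on
  \<open>[-N, N]\<close> once \<open>v\<close> is small. The obstacle is that \<open>Z\<close> has
  to be bounded. For large \<open>s\<close> the truncation cuts into \<open>[-N, N]\<close>, and
  there neither closeness to \<open>exp (t u)\<close> nor compactness in \<open>t\<close> helps. The
  strict inequality of the essential maxima takes over: it yields a threshold \<open>T\<close> that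
  serves every cut point and every \<open>v\<close> in \<open>[0, 1]\<close>. Hence the order of
  choices: \<open>T\<close> before \<open>v\<close>, and \<open>v\<close> before \<open>A\<close>,
  where \<open>A >= N + T / (2 v)\<close> keeps the cut outside \<open>[-N, N]\<close> as long as
  \<open>t < T\<close>. Nonatomicity has a separate purpose: the claim includes a bounded variable
  with c.d.f. \<open>H\<close> on the given space itself, and such a variable has to be
  constructed.\<close>

context prob_space
begin

text \<open>Nonatomicity only gives a part of strictly smaller positive measure; either this part or
  its complement in \<open>A\<close> has at most half of the measure.\<close>

lemma nonatomic_obtain_half:
  assumes "nonatomic M" "A \<in> sets M" "0 < measure M A"
  obtains B where "B \<in> sets M" "B \<subseteq> A" "0 < measure M B" "measure M B \<le> measure M A / 2"
proof -
  have "0 < emeasure M A" using assms(3) by (simp add: emeasure_eq_measure)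
  then obtain B where B: "B \<in> sets M" "B \<subseteq> A" "0 < measure M B" "measure M B < measure M A"
  proof -
    assume *: "\<And>B. B \<in> sets M \<Longrightarrow> B \<subseteq> A \<Longrightarrow> 0 < measure M B \<Longrightarrow> measure M B < measure M A \<Longrightarrow> thesis"
    obtain B where "B \<in> sets M" "B \<subseteq> A" "0 < emeasure M B" "emeasure M B < emeasure M A"
      using assms(1,2) \<open>0 < emeasure M A\<close> unfolding nonatomic_def by blast
    then show thesis by (intro *) (simp_all add: emeasure_eq_measure ennreal_less_iff)
  qed
  have diff: "measure M (A - B) = measure M A - measure M B"
    by (rule finite_measure_Diff[OF assms(2) B(1,2)])
  show thesis
  proof (cases "measure M B \<le> measure M A / 2")
    case True
    then show thesis using B that by blast
  next
    case False
    then show thesis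
      using B(1,4) assms(2) diff by (intro that[of "A - B"]) simp_all
  qed
qed

text \<open>Splitting along these halves forces the measure of the cells to $0$ along every branch.\<close>

lemma nearly_largest_half:
  assumes "A \<in> sets M"
  shows "\<exists>B \<in> sets M. B \<subseteq> A \<and> measure M B \<le> measure M A / 2 \<and>
    (\<forall>C \<in> sets M. C \<subseteq> A \<longrightarrow> measure M C \<le> measure M A / 2 \<longrightarrow> measure M C \<le> 2 * measure M B)"
proof -
  define S where "S = {measure M C | C. C \<in> sets M \<and> C \<subseteq> A \<and> measure M C \<le> measure M A / 2}"
  have S0: "0 \<in> S" unfolding S_def mem_Collect_eq by (rule exI[of _ "{}"]) simp
  have bdd: "bdd_above S" by (rule bdd_aboveI[of _ "measure M A / 2"]) (auto simp: S_def)
  \<comment> \<open>The supremum need not be attained, and the factor 2 pays for that. It also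
    covers a vanishing supremum, where \<open>y = 0\<close> is taken.\<close>
  have "\<exists>y \<in> S. Sup S \<le> 2 * y"
  proof (cases "Sup S \<le> 0")
    case True
    then show ?thesis using S0 by (intro bexI[of _ 0]) simp_all
  next
    case False
    then have "Sup S / 2 < Sup S" by auto
    then obtain y where "y \<in> S" "Sup S / 2 < y"
      using less_cSup_iff[of S "Sup S / 2"] S0 bdd by blast
    then show ?thesis by (intro bexI[of _ y]) simp_all
  qed
  then obtain B where B: "B \<in> sets M" "B \<subseteq> A" "measure M B \<le> measure M A / 2"
    "Sup S \<le> 2 * measure M B"
    by (auto simp: S_def)
  have max: "measure M C \<le> 2 * measure M B"
    if "C \<in> sets M" "C \<subseteq> A" "measure M C \<le> measure M A / 2" for C
  proof -
    have "measure M C \<in> S" unfolding S_def using that by blast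
    from cSup_upper[OF this bdd] show ?thesis using B(4) by simp
  qed
  show ?thesis by (intro bexI[of _ B] conjI ballI impI) (rule B max; assumption)+
qed

end

section \<open>Coding bit sequences by real numbers\<close>

definition bit_code :: "(nat \<Rightarrow> bool) \<Rightarrow> real" where
  "bit_code b = (\<Sum>n. if b n then (1 / 3) ^ n else 0)"

lemma summable_bit_code: "summable (\<lambda>n. if b n then (1 / 3 :: real) ^ n else 0)"
  by (rule summable_comparison_test'[of "\<lambda>n. (1 / 3) ^ n" 0]) auto

text \<open>Base 3 instead of 2 makes the code injective.\<close>

lemma inj_bit_code: "inj bit_code"
proof (rule injI, rule ccontr)
  fix b b' assume eq: "bit_code b = bit_code b'" and "b \<noteq> b'"
  then have ex: "\<exists>n. b n \<noteq> b' n" by auto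
  define n where "n = (LEAST n. b n \<noteq> b' n)"
  have n: "b n \<noteq> b' n" unfolding n_def using ex by (rule LeastI_ex)
  have lt: "b k = b' k" if "k < n" for k using not_less_Least[of k] that unfolding n_def by blast
  have less: "bit_code c < bit_code d"
    if n: "\<not> c n" "d n" and lt: "\<And>k. k < n \<Longrightarrow> c k = d k" for c d
  proof -
    let ?f = "\<lambda>b k. if b k then (1 / 3 :: real) ^ k else 0"
    have "bit_code c = (\<Sum>k. ?f c (k + Suc n)) + (\<Sum>k<Suc n. ?f c k)"
      unfolding bit_code_def by (rule suminf_split_initial_segment[OF summable_bit_code])
    also have "(\<Sum>k<Suc n. ?f c k) = (\<Sum>k<n. ?f d k)"
      using n lt by (auto intro!: sum.cong)
    \<comment> \<open>All digits after the first difference together weigh at most half of the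
      weight \<open>(1 / 3) ^ n\<close> of that digit. In base 2 the two could be equal.\<close>
    also have "(\<Sum>k. ?f c (k + Suc n)) \<le> (\<Sum>k. (1 / 3) ^ Suc n * (1 / 3) ^ k)"
      by (intro suminf_le summable_ignore_initial_segment[OF summable_bit_code] summable_mult)
        (auto simp: power_add)
    also have "\<dots> = (1 / 3) ^ Suc n * (3 / 2)"
      by (subst suminf_mult) (auto simp: suminf_geometric)
    also have "\<dots> < (1 / 3) ^ n" by simp
    also have "(1 / 3) ^ n + (\<Sum>k<n. ?f d k) = (\<Sum>k<Suc n. ?f d k)" using n by simp
    also have "\<dots> \<le> bit_code d"
      unfolding bit_code_def by (rule sum_le_suminf[OF summable_bit_code]) auto
    finally show ?thesis by simp
  qed
  show False
  proof (cases "b n")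
    case True
    then have "bit_code b' < bit_code b" using n lt by (intro less) auto
    then show False using eq by simp
  next
    case False
    then have "bit_code b < bit_code b'" using n lt by (intro less) auto
    then show False using eq by simp
  qed
qed

text \<open>A binary tree of cells is grown by splitting each cell \<open>A\<close> into
  \<open>B A\<close> and the rest, and \<open>U\<close> encodes the branch that a point follows. By
  injectivity of the code a level set of \<open>U\<close> lies in all cells of one branch. If it had
  positive measure, it would contain a set \<open>C\<close> that competes with every
  \<open>B A\<close> along the branch, so each split would remove at least half the measure of
  \<open>C\<close>, which cannot go on forever.\<close>

lemma (in prob_space) nonatomic_imp_continuous_rv:
  assumes na: "nonatomic M"
  obtains U :: "'a \<Rightarrow> real" where "U \<in> borel_measurable M"
    "\<And>u. measure M {\<omega> \<in> space M. U \<omega> = u} = 0"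
proof -
  have "\<exists>B. \<forall>A \<in> sets M. B A \<in> sets M \<and> B A \<subseteq> A \<and> measure M (B A) \<le> measure M A / 2 \<and>
    (\<forall>C \<in> sets M. C \<subseteq> A \<longrightarrow> measure M C \<le> measure M A / 2 \<longrightarrow> measure M C \<le> 2 * measure M (B A))"
  proof (rule bchoice, rule ballI)
    fix A assume "A \<in> sets M"
    from nearly_largest_half[OF this]
    show "\<exists>B. B \<in> sets M \<and> B \<subseteq> A \<and> measure M B \<le> measure M A / 2 \<and>
      (\<forall>C \<in> sets M. C \<subseteq> A \<longrightarrow> measure M C \<le> measure M A / 2 \<longrightarrow> measure M C \<le> 2 * measure M B)"
      unfolding Bex_def .
  qed
  then obtain B where B: "\<And>A. A \<in> sets M \<Longrightarrow> B A \<in> sets M" "\<And>A. A \<in> sets M \<Longrightarrow> B A \<subseteq> A"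
    "\<And>A. A \<in> sets M \<Longrightarrow> measure M (B A) \<le> measure M A / 2"
    "\<And>A C. A \<in> sets M \<Longrightarrow> C \<in> sets M \<Longrightarrow> C \<subseteq> A \<Longrightarrow> measure M C \<le> measure M A / 2 \<Longrightarrow>
      measure M C \<le> 2 * measure M (B A)"
    by metis
  \<comment> \<open>The head of the list is the latest decision, so descending one level is a Cons,
    and \<open>cell\<close> and \<open>path\<close> unfold in step.\<close>
  define cell where
    "cell = rec_list (space M) (\<lambda>b l A. if b then B A else A - B A)"
  have cell_simps: "cell [] = space M"
    "cell (b # l) = (if b then B (cell l) else cell l - B (cell l))" for b l
    by (simp_all add: cell_def)
  have cell_sets: "cell l \<in> sets M" for l
    by (induction l) (auto simp: cell_simps B)
  define path where "path \<omega> = rec_nat [] (\<lambda>n l. (\<omega> \<in> B (cell l)) # l)" for \<omega>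
  have path_simps: "path \<omega> 0 = []" "path \<omega> (Suc n) = (\<omega> \<in> B (cell (path \<omega> n))) # path \<omega> n" for \<omega> n
    by (simp_all add: path_def)
  have in_cell: "\<omega> \<in> cell (path \<omega> n)" if "\<omega> \<in> space M" for \<omega> n
    by (induction n) (auto simp: path_simps cell_simps that)
  \<comment> \<open>This encodes the disjointness of the cells of one level: a point determines the
    list of its cell.\<close>
  have path_eq: "path \<omega> (length l) = l" if "\<omega> \<in> cell l" for \<omega> l
    using that
  proof (induction l)
    case (Cons b l)
    then have "\<omega> \<in> cell l" using B(2)[OF cell_sets[of l]] by (auto simp: cell_simps split: if_splits)
    then show ?case using Cons by (auto simp: path_simps cell_simps split: if_splits)
  qed (simp add: path_simps)
  define bit where "bit \<omega> n = (\<omega> \<in> B (cell (path \<omega> n)))" for \<omega> n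
  have "{\<omega> \<in> space M. bit \<omega> n} = (\<Union>l \<in> {l. length l = n}. B (cell l))" for n
  proof (intro equalityI subsetI)
    fix \<omega> assume "\<omega> \<in> {\<omega> \<in> space M. bit \<omega> n}"
    moreover have "length (path \<omega> n) = n" by (induction n) (auto simp: path_simps)
    ultimately show "\<omega> \<in> (\<Union>l \<in> {l. length l = n}. B (cell l))" by (auto simp: bit_def)
  next
    fix \<omega> assume "\<omega> \<in> (\<Union>l \<in> {l. length l = n}. B (cell l))"
    then obtain l where l: "length l = n" "\<omega> \<in> B (cell l)" by blast
    then have "\<omega> \<in> cell l" using B(2)[OF cell_sets] by blast
    then show "\<omega> \<in> {\<omega> \<in> space M. bit \<omega> n}"
      using l path_eq[of \<omega> l] sets.sets_into_space[OF cell_sets[of l]] by (auto simp: bit_def)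
  qed
  moreover have "(\<Union>l \<in> {l :: bool list. length l = n}. B (cell l)) \<in> sets M" for n
    by (intro sets.countable_UN') (auto simp: B cell_sets)
  ultimately have bit_meas [measurable]: "Measurable.pred M (\<lambda>\<omega>. bit \<omega> n)" for n
    by (simp add: pred_def)
  define U where "U \<omega> = bit_code (bit \<omega>)" for \<omega>
  have U_meas: "U \<in> borel_measurable M" unfolding U_def bit_code_def by measurable
  moreover have "measure M {\<omega> \<in> space M. U \<omega> = u} = 0" for u
  proof (cases "{\<omega> \<in> space M. U \<omega> = u} = {}")
    case False
    then obtain \<omega>0 where \<omega>0: "\<omega>0 \<in> space M" "U \<omega>0 = u" by blast
    define A where "A n = cell (path \<omega>0 n)" for n
    define D where "D = {\<omega> \<in> space M. U \<omega> = u}"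
    have D: "D \<in> sets M" unfolding D_def using U_meas by measurable
    have A_sets: "A n \<in> sets M" for n by (simp add: A_def cell_sets)
    have DA: "D \<subseteq> A n" for n
    proof
      fix \<omega> assume "\<omega> \<in> D"
      then have \<omega>: "\<omega> \<in> space M" "bit \<omega> = bit \<omega>0"
        using \<omega>0 inj_eq[OF inj_bit_code, of "bit \<omega>" "bit \<omega>0"] by (simp_all add: D_def U_def)
      have path_Suc: "path \<omega> (Suc n) = bit \<omega> n # path \<omega> n" for \<omega> n
        by (simp add: path_simps bit_def)
      have "path \<omega> n = path \<omega>0 n" for n
        by (induction n) (simp add: path_simps, simp only: path_Suc \<omega>)
      then show "\<omega> \<in> A n" using in_cell[OF \<omega>(1), of n] by (simp add: A_def)
    qed
    \<comment> \<open>Whichever child the branch enters, it loses at least the measure of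
      \<open>B (A n)\<close>, since the other child is \<open>B (A n)\<close> or is at least as
      large.\<close>
    have drop: "measure M (A (Suc n)) \<le> measure M (A n) - measure M (B (A n))" for n
    proof (cases "\<omega>0 \<in> B (A n)")
      case True
      then have "A (Suc n) = B (A n)" by (simp add: A_def path_simps cell_simps)
      then show ?thesis using B(3)[OF A_sets[of n]] by simp
    next
      case False
      then have "A (Suc n) = A n - B (A n)" by (simp add: A_def path_simps cell_simps)
      then show ?thesis using finite_measure_Diff[OF A_sets B(1,2)[OF A_sets]] by simp
    qed
    show ?thesis
    proof (rule ccontr)
      assume "measure M {\<omega> \<in> space M. U \<omega> = u} \<noteq> 0"
      then have "0 < measure M D" by (simp add: D_def zero_less_measure_iff)
      then obtain C where C: "C \<in> sets M" "C \<subseteq> D" "0 < measure M C" "measure M C \<le> measure M D / 2"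
        using nonatomic_obtain_half[OF na D] by metis
      have step: "measure M (A (Suc n)) \<le> measure M (A n) - measure M C / 2" for n
      proof -
        have "measure M D \<le> measure M (A n)" by (intro finite_measure_mono DA A_sets)
        then have "measure M C \<le> measure M (A n) / 2" using C(4) by linarith
        then have "measure M C \<le> 2 * measure M (B (A n))"
          using C(1,2) DA[of n] B(4)[OF A_sets] by blast
        then show ?thesis using drop[of n] by linarith
      qed
      have "measure M (A n) \<le> 1 - real n * (measure M C / 2)" for n
      proof (induction n)
        case (Suc n)
        then show ?case using step[of n] by (simp add: algebra_simps add_divide_distrib)
      qed simp
      moreover obtain n where "1 < real n * (measure M C / 2)"
        using reals_Archimedean3[of "measure M C / 2"] C(3) half_gt_zero by blast
      ultimately show False using measure_nonneg[of M "A n"] by (smt (verit))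
    qed
  qed (simp only: measure_empty)
  ultimately show thesis by (rule that)
qed

text \<open>The probability integral transform. For a level strictly between 0 and 1 the event
  \<open>F (U \<omega>) \<le> q\<close> is the event \<open>U \<omega> \<le> m\<close>, where
  \<open>m\<close> is the last point at which the continuous \<open>F\<close> takes the value
  \<open>q\<close>. The two extreme levels are treated separately.\<close>

lemma (in prob_space) cdf_of_continuous_rv_uniform:
  assumes U [measurable]: "U \<in> borel_measurable M"
    and cont: "\<And>u. measure M {\<omega> \<in> space M. U \<omega> = u} = 0"
    and p: "0 \<le> p" "p \<le> 1"
  defines "F \<equiv> cdf (distr M borel U)"
  shows "measure M {\<omega> \<in> space M. F (U \<omega>) \<le> p} = p"
proof -
  interpret U: real_distribution "distr M borel U" by simp
  have Fm [measurable]: "F \<in> borel_measurable borel"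
    unfolding F_def by (intro borel_measurable_mono monoI U.cdf_nondecreasing)
  have isCont: "isCont F x" for x
    unfolding F_def U.isCont_cdf using cont[of x]
    by (simp add: measure_distr vimage_def Int_def conj_commute)
  have F_eq: "F x = measure M {\<omega> \<in> space M. U \<omega> \<le> x}" for x
    unfolding F_def cdf_def by (simp add: measure_distr vimage_def Int_def conj_commute)
  have inner: "measure M {\<omega> \<in> space M. F (U \<omega>) \<le> q} = q" if q: "0 < q" "q < 1" for q
  proof -
    obtain a where a: "F a < q"
      using eventually_happens'[OF trivial_limit_at_bot_linorder order_tendstoD(2)[OF U.cdf_lim_at_bot q(1)]]
      unfolding F_def by blast
    obtain b where b: "q < F b"
      using eventually_happens'[OF trivial_limit_at_top_linorder order_tendstoD(1)[OF U.cdf_lim_at_top_prob q(2)]]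
      unfolding F_def by blast
    have mono: "x \<le> y \<Longrightarrow> F x \<le> F y" for x y unfolding F_def by (rule U.cdf_nondecreasing)
    define S where "S = {x. F x \<le> q}"
    have bdd: "x \<le> b" if "x \<in> S" for x using mono[of b x] b that unfolding S_def by force
    have "a \<in> S" using a by (simp add: S_def)
    have cl: "closed S" unfolding S_def
      using isCont by (intro closed_Collect_le continuous_at_imp_continuous_on) auto
    \<comment> \<open>The last point of level \<open>q\<close> is needed and not just any:
      \<open>F\<close> may be flat there, and \<open>F y \<le> q\<close> has to be equivalent to
      \<open>y \<le> m\<close>.\<close>
    define m where "m = Sup S"
    have m: "m \<in> S" unfolding m_def using bdd \<open>a \<in> S\<close>
      by (intro closed_contains_Sup cl) (auto intro!: bdd_aboveI)
    have "F m = q"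
    proof -
      have "a \<le> m" unfolding m_def using bdd \<open>a \<in> S\<close> by (intro cSup_upper bdd_aboveI) auto
      have "m \<le> b" using m bdd by auto
      obtain x where x: "F x = q"
        using IVT[of F a q b] a b isCont bdd[OF \<open>a \<in> S\<close>] less_imp_le by blast
      then have "x \<le> m" unfolding m_def using bdd by (intro cSup_upper bdd_aboveI) (auto simp: S_def)
      then show ?thesis using mono[of x m] x m by (auto simp: S_def)
    qed
    moreover have "F y \<le> q \<longleftrightarrow> y \<le> m" for y
    proof
      assume "F y \<le> q"
      then show "y \<le> m" unfolding m_def using bdd by (intro cSup_upper bdd_aboveI) (auto simp: S_def)
    qed (use mono[of y m] \<open>F m = q\<close> in simp)
    ultimately have "measure M {\<omega> \<in> space M. F (U \<omega>) \<le> q} = measure M {\<omega> \<in> space M. U \<omega> \<le> m}"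
      by presburger
    then show ?thesis using F_eq[of m] \<open>F m = q\<close> by presburger
  qed
  have "F y \<le> 1" for y unfolding F_def by (rule U.cdf_bounded_prob)
  \<comment> \<open>\<open>F\<close> need not attain the value 0, so the intermediate value argument
    fails at this level; it is squeezed by small positive levels instead.\<close>
  have "measure M {\<omega> \<in> space M. F (U \<omega>) \<le> 0} \<le> q" if "0 < q" "q < 1" for q
  proof -
    have "measure M {\<omega> \<in> space M. F (U \<omega>) \<le> 0} \<le> measure M {\<omega> \<in> space M. F (U \<omega>) \<le> q}"
      using that by (intro finite_measure_mono) auto
    then show ?thesis using inner[OF that] by simp
  qed
  then have "measure M {\<omega> \<in> space M. F (U \<omega>) \<le> 0} \<le> 0"
    by (intro dense_ge_bounded[of 0 1]) auto
  then have "measure M {\<omega> \<in> space M. F (U \<omega>) \<le> 0} = 0" by (simp add: measure_le_0_iff)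
  moreover have "measure M {\<omega> \<in> space M. F (U \<omega>) \<le> 1} = 1"
    using \<open>\<And>y. F y \<le> 1\<close> by (simp add: prob_space)
  moreover have "p = 0 \<or> p = 1 \<or> (0 < p \<and> p < 1)" using p by linarith
  ultimately show ?thesis using inner by metis
qed

text \<open>Inverse transform sampling: the quantile function of \<open>\<mu>\<close> applied to a
  uniform variable has law \<open>\<mu>\<close>. It is used to realise the law of the noise on the
  given space.\<close>

lemma (in prob_space) nonatomic_imp_rv_with_distribution:
  assumes "nonatomic M" and "real_distribution \<mu>"
  obtains W where "W \<in> borel_measurable M" "distr M borel W = \<mu>"
proof -
  obtain U :: "'a \<Rightarrow> real" where [measurable]: "U \<in> borel_measurable M"
    and cont: "\<And>u. measure M {\<omega> \<in> space M. U \<omega> = u} = 0"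
    using nonatomic_imp_continuous_rv[OF assms(1)] by blast
  interpret \<mu>: cdf_distribution \<mu> using assms(2) by (simp add: cdf_distribution_def)
  interpret U: real_distribution "distr M borel U" by simp
  define V where "V \<omega> = cdf (distr M borel U) (U \<omega>)" for \<omega>
  have [measurable]: "cdf (distr M borel U) \<in> borel_measurable borel"
    by (intro borel_measurable_mono monoI U.cdf_nondecreasing)
  have [measurable]: "V \<in> borel_measurable M" unfolding V_def by measurable
  have unif: "prob {\<omega> \<in> space M. V \<omega> \<le> p} = p" if "0 \<le> p" "p \<le> 1" for p
    unfolding V_def by (rule cdf_of_continuous_rv_uniform) (use cont that in auto)
  have "prob {\<omega> \<in> space M. V \<omega> \<le> 0} = 0" using unif[of 0] by simp
  then have "AE \<omega> in M. \<not> V \<omega> \<le> 0" by (subst (asm) prob_Collect_eq_0) measurable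
  then have pos: "AE \<omega> in M. 0 < V \<omega>" by (simp add: not_le)
  \<comment> \<open>Uniformity is known only for events of the form
    \<open>V \<omega> \<le> p\<close>; the strict event at 1 is approximated by levels
    \<open>q < 1\<close>.\<close>
  have lt1: "AE \<omega> in M. V \<omega> < 1"
  proof -
    have "q \<le> prob {\<omega> \<in> space M. V \<omega> < 1}" if "0 < q" "q < 1" for q
    proof -
      have "q = prob {\<omega> \<in> space M. V \<omega> \<le> q}" using unif[of q] that by simp
      also have "\<dots> \<le> prob {\<omega> \<in> space M. V \<omega> < 1}"
        using that by (intro finite_measure_mono) auto
      finally show ?thesis .
    qed
    then have "1 \<le> prob {\<omega> \<in> space M. V \<omega> < 1}" by (intro dense_le_bounded[of 0 1]) simp_all
    then have "prob {\<omega> \<in> space M. V \<omega> < 1} = 1" by (intro antisym prob_le_1)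
    then show ?thesis by (subst (asm) prob_Collect_eq_1) measurable
  qed
  \<comment> \<open>The quantile function is meaningful only at levels strictly between 0 and 1. The
    default value 0 is taken on a null event.\<close>
  define W where "W \<omega> = (if 0 < V \<omega> \<and> V \<omega> < 1 then \<mu>.I (V \<omega>) else 0)" for \<omega>
  have [measurable]: "W \<in> borel_measurable M"
  proof -
    have "W = (\<lambda>v. if v \<in> {0<..<1} then \<mu>.I v else 0) \<circ> V" by (simp add: W_def fun_eq_iff)
    moreover have "(\<lambda>v. if v \<in> {0<..<1} then \<mu>.I v else 0) \<in> borel_measurable borel"
    proof (subst measurable_If_restrict_space_iff)
      have "{v :: real. v \<in> {0<..<1}} = {0<..<1}" by blast
      then show "\<mu>.I \<in> borel_measurable (restrict_space borel {v. v \<in> {0<..<1}}) \<and>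
          (\<lambda>v. 0) \<in> borel_measurable (restrict_space borel {v. v \<notin> {0<..<1}})"
        using \<mu>.measurable_CI by simp
    qed auto
    ultimately show ?thesis
      using measurable_comp[of V M borel "\<lambda>v. if v \<in> {0<..<1} then \<mu>.I v else 0" borel] by simp
  qed
  have "cdf (distr M borel W) x = cdf \<mu> x" for x
  proof -
    have "cdf (distr M borel W) x = prob {\<omega> \<in> space M. W \<omega> \<le> x}"
      unfolding cdf_def by (simp add: measure_distr vimage_def Int_def conj_commute)
    \<comment> \<open>The Galois connection between quantile function and c.d.f., which holds at
      levels in the open unit interval and hence almost surely.\<close>
    also have "\<dots> = prob {\<omega> \<in> space M. V \<omega> \<le> cdf \<mu> x}"
    proof (rule finite_measure_eq_AE)
      show "AE \<omega> in M. \<omega> \<in> {\<omega> \<in> space M. W \<omega> \<le> x} \<longleftrightarrow> \<omega> \<in> {\<omega> \<in> space M. V \<omega> \<le> cdf \<mu> x}"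
        using pos lt1
      proof eventually_elim
        case (elim \<omega>)
        then show ?case using \<mu>.pseudoinverse[of "V \<omega>" x] by (simp add: W_def)
      qed
    qed measurable
    also have "\<dots> = cdf \<mu> x" by (intro unif \<mu>.cdf_nonneg \<mu>.cdf_bounded_prob)
    finally show ?thesis .
  qed
  then have "distr M borel W = \<mu>"
    by (intro cdf_unique ext real_distribution_distr assms(2)) measurable
  then show thesis by (rule that[rotated]) measurable
qed

subsection \<open>The truncated Gaussian kernel\<close>

definition partial_integral :: "real \<Rightarrow> (real \<Rightarrow> real) \<Rightarrow> real \<Rightarrow> real" where
  "partial_integral N k x = (\<integral>u. (if - N \<le> u \<and> u \<le> x then k u else 0) \<partial>lborel)"

lemma partial_integral_measurable [measurable]:
  assumes [measurable]: "k \<in> borel_measurable borel"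
  shows "partial_integral N k \<in> borel_measurable borel"
  unfolding partial_integral_def by measurable

lemma partial_integrable:
  fixes k :: "real \<Rightarrow> real"
  assumes [measurable]: "k \<in> borel_measurable borel"
    and "\<And>u. \<bar>u\<bar> \<le> N \<Longrightarrow> \<bar>k u\<bar> \<le> C" and "x \<le> N"
  shows "integrable lborel (\<lambda>u. if - N \<le> u \<and> u \<le> x then k u else 0)"
proof (rule Bochner_Integration.integrable_bound[where f = "\<lambda>u. C * indicator {- N..N} u :: real"])
  have "integrable lborel (indicator {- N..N} :: real \<Rightarrow> real)"
    by (rule integrable_real_indicator) (simp_all add: emeasure_lborel_Icc_eq)
  then show "integrable lborel (\<lambda>u. C * indicator {- N..N} u :: real)" by simp
  show "AE u in lborel. norm (if - N \<le> u \<and> u \<le> x then k u else 0) \<le> norm (C * indicator {- N..N} u :: real)"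
  proof (rule AE_I2)
    fix u show "norm (if - N \<le> u \<and> u \<le> x then k u else 0) \<le> norm (C * indicator {- N..N} u :: real)"
    proof (cases "- N \<le> u \<and> u \<le> x")
      case True
      then have "\<bar>u\<bar> \<le> N" using assms(3) by linarith
      from assms(2)[OF this] have "\<bar>k u\<bar> \<le> \<bar>C\<bar>" by linarith
      then show ?thesis using True assms(3) by (simp add: indicator_def)
    qed auto
  qed
qed measurable

lemma partial_integral_diff_le:
  fixes k k' :: "real \<Rightarrow> real"
  assumes [measurable]: "k \<in> borel_measurable borel" "k' \<in> borel_measurable borel"
    and bd: "\<And>u. \<bar>u\<bar> \<le> N \<Longrightarrow> \<bar>k u\<bar> \<le> C" "\<And>u. \<bar>u\<bar> \<le> N \<Longrightarrow> \<bar>k' u\<bar> \<le> C'"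
    and diff: "\<And>u. \<bar>u\<bar> \<le> N \<Longrightarrow> \<bar>k u - k' u\<bar> \<le> e" and x: "x \<le> N" and N: "0 \<le> N" and e: "0 \<le> e"
  shows "\<bar>partial_integral N k x - partial_integral N k' x\<bar> \<le> 2 * N * e"
proof -
  let ?f = "\<lambda>k u. if - N \<le> u \<and> u \<le> x then k u else 0 :: real"
  have int: "integrable lborel (?f k)" "integrable lborel (?f k')"
    using partial_integrable[of k N C x] partial_integrable[of k' N C' x] bd x by simp_all
  have "partial_integral N k x - partial_integral N k' x = (\<integral>u. ?f k u - ?f k' u \<partial>lborel)"
    unfolding partial_integral_def using int by (rule Bochner_Integration.integral_diff[symmetric])
  also have "norm \<dots> \<le> (\<integral>u. e * indicator {- N..N} u \<partial>lborel)"
  proof (rule Bochner_Integration.integral_norm_bound_integral)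
    show "integrable lborel (\<lambda>u. ?f k u - ?f k' u)"
      using int by (rule Bochner_Integration.integrable_diff)
    have "integrable lborel (indicator {- N..N} :: real \<Rightarrow> real)"
      by (rule integrable_real_indicator) (simp_all add: emeasure_lborel_Icc_eq)
    then show "integrable lborel (\<lambda>u. e * indicator {- N..N} u :: real)"
      by (rule integrable_mult_right)
    fix u show "norm (?f k u - ?f k' u) \<le> e * indicator {- N..N} u"
    proof (cases "- N \<le> u \<and> u \<le> x")
      case True
      then have "\<bar>u\<bar> \<le> N" using x by linarith
      from diff[OF this] show ?thesis using True x by (simp add: indicator_def)
    next
      case False
      then have "?f k u = 0" "?f k' u = 0" by argo+
      then have "norm (?f k u - ?f k' u) = 0" by (simp only: diff_self norm_zero)
      then show ?thesis using e by (simp only: mult_nonneg_nonneg indicator_pos_le)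
    qed
  qed
  also have "\<dots> = 2 * N * e" using N by simp
  finally show ?thesis by simp
qed

lemma partial_integral_cong:
  assumes "\<And>u. - N \<le> u \<Longrightarrow> u \<le> x \<Longrightarrow> k u = k' u"
  shows "partial_integral N k x = partial_integral N k' x"
  unfolding partial_integral_def
  by (intro Bochner_Integration.integral_cong refl) (use assms in simp)

lemma partial_integral_cmult: "partial_integral N (\<lambda>u. c * k u) x = c * partial_integral N k x"
proof -
  have "(\<lambda>u. if - N \<le> u \<and> u \<le> x then c * k u else 0) = (\<lambda>u. c * (if - N \<le> u \<and> u \<le> x then k u else 0))"
    by (simp add: fun_eq_iff)
  then show ?thesis by (simp add: partial_integral_def)
qed

lemma partial_integral_mono:
  assumes "k \<in> borel_measurable borel" "\<And>u. \<bar>u\<bar> \<le> N \<Longrightarrow> \<bar>k u\<bar> \<le> C"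
    and nn: "\<And>u. 0 \<le> k u" and "x \<le> y" "y \<le> N"
  shows "partial_integral N k x \<le> partial_integral N k y"
  unfolding partial_integral_def
proof (rule integral_mono)
  show "integrable lborel (\<lambda>u. if - N \<le> u \<and> u \<le> x then k u else 0)"
    using assms(4,5) by (intro partial_integrable[OF assms(1,2)]) simp_all
  show "integrable lborel (\<lambda>u. if - N \<le> u \<and> u \<le> y then k u else 0)"
    using assms(4,5) by (intro partial_integrable[OF assms(1,2)]) simp_all
  show "(if - N \<le> u \<and> u \<le> x then k u else 0) \<le> (if - N \<le> u \<and> u \<le> y then k u else 0)" for u
    using nn[of u] \<open>x \<le> y\<close> by simp
qed

lemma partial_integral_nonneg: "(\<And>u. 0 \<le> k u) \<Longrightarrow> 0 \<le> partial_integral N k x"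
  unfolding partial_integral_def by (intro integral_nonneg_AE AE_I2) simp

text \<open>This links the kernel to the hypotheses: for an exponential kernel the partial integral
  is an affine function of \<open>exp (t * x)\<close>, or of \<open>x\<close> if
  \<open>t = 0\<close>, so its expectations compare moment generating functions, or means.\<close>

lemma partial_integral_exp:
  assumes "- N \<le> x"
  shows "partial_integral N (\<lambda>u. exp (t * u)) x = (if t = 0 then x + N else (exp (t * x) - exp (- t * N)) / t)"
proof -
  have eq: "(if - N \<le> u \<and> u \<le> x then exp (t * u) else 0) = exp (t * u) * indicator {- N..x} u" for u
    by (simp add: indicator_def)
  show ?thesis
  proof (cases "t = 0")
    case True
    have "(\<lambda>u. if - N \<le> u \<and> u \<le> x then exp (t * u) else 0) = (indicator {- N..x} :: real \<Rightarrow> real)"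
      using True by (simp add: indicator_def fun_eq_iff)
    then have "partial_integral N (\<lambda>u. exp (t * u)) x = measure lborel {- N..x}"
      unfolding partial_integral_def by simp
    then show ?thesis using True assms by simp
  next
    case False
    have "(\<integral>u. exp (t * u) * indicator {- N..x} u \<partial>lborel) = exp (t * x) / t - exp (t * (- N)) / t"
    proof (rule integral_FTC_Icc_real)
      show "DERIV (\<lambda>u. exp (t * u) / t) u :> exp (t * u)" for u
        using False by (auto intro!: derivative_eq_intros)
    qed (use assms in auto)
    then show ?thesis using False by (simp add: partial_integral_def eq diff_divide_distrib)
  qed
qed

lemma exp_diff_le:
  fixes a b :: real
  assumes "\<bar>a\<bar> \<le> C" "\<bar>b\<bar> \<le> C"
  shows "\<bar>exp a - exp b\<bar> \<le> exp C * \<bar>a - b\<bar>"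
proof -
  \<comment> \<open>The tangent of the exponential at \<open>a\<close> lies below the graph. Only
    \<open>a\<close> has to be bounded, so exchanging the two points gives the other sign.\<close>
  have *: "exp a - exp b \<le> exp C * \<bar>a - b\<bar>" if "\<bar>a\<bar> \<le> C" for a b :: real
  proof -
    have "exp b = exp a * exp (b - a)" by (simp add: exp_diff)
    moreover have "1 + (b - a) \<le> exp (b - a)" by (rule exp_ge_add_one_self)
    ultimately have "exp a - exp b \<le> exp a * (a - b)"
      using mult_left_mono[of "1 + (b - a)" "exp (b - a)" "exp a"] by (simp add: algebra_simps)
    also have "\<dots> \<le> exp a * \<bar>a - b\<bar>" by (intro mult_left_mono) simp_all
    also have "\<dots> \<le> exp C * \<bar>a - b\<bar>" using that by (intro mult_right_mono) simp_all
    finally show ?thesis .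
  qed
  show ?thesis using *[of a b] *[of b a] assms by (simp add: abs_minus_commute abs_le_iff)
qed

section \<open>The truncated Gaussian density and its integral function\<close>

definition trunc_gauss :: "real \<Rightarrow> real \<Rightarrow> real \<Rightarrow> real" where
  "trunc_gauss A v z = (if \<bar>z\<bar> \<le> A then exp (- (v * z\<^sup>2)) else 0)"

lemma trunc_gauss_measurable [measurable]: "trunc_gauss A v \<in> borel_measurable borel"
  unfolding trunc_gauss_def by measurable

lemma trunc_gauss_bounds:
  assumes "0 \<le> v" shows "0 \<le> trunc_gauss A v z" "\<bar>trunc_gauss A v z\<bar> \<le> 1"
  using assms by (simp_all add: trunc_gauss_def)

text \<open>Not normalised: the limit at infinity is the integral of the density.\<close>

definition gauss_cdf :: "real \<Rightarrow> real \<Rightarrow> real \<Rightarrow> real" where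
  "gauss_cdf A v w = (\<integral>z. (if z \<le> w then trunc_gauss A v z else 0) \<partial>lborel)"

lemma integrable_trunc_gauss:
  assumes "0 \<le> v"
  shows "integrable lborel (trunc_gauss A v)"
proof (rule Bochner_Integration.integrable_bound)
  show "integrable lborel (indicator {- A..A} :: real \<Rightarrow> real)"
    by (rule integrable_real_indicator) (simp_all add: emeasure_lborel_Icc_eq)
  show "AE z in lborel. norm (trunc_gauss A v z) \<le> norm (indicator {- A..A} z :: real)"
    using assms by (intro AE_I2) (simp add: trunc_gauss_def indicator_def abs_le_iff)
qed measurable

lemma integrable_trunc_gauss_restrict:
  assumes "0 \<le> v" and [measurable]: "Measurable.pred borel P"
  shows "integrable lborel (\<lambda>z. if P z then trunc_gauss A v z else 0)"
  by (rule Bochner_Integration.integrable_bound[OF integrable_trunc_gauss[OF assms(1), of A]])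
    (simp_all add: trunc_gauss_bounds[OF assms(1)])

lemma gauss_cdf_measurable [measurable]: "gauss_cdf A v \<in> borel_measurable borel"
  unfolding gauss_cdf_def by measurable

lemma gauss_cdf_bounds:
  assumes "0 \<le> v"
  shows "0 \<le> gauss_cdf A v w" "gauss_cdf A v w \<le> (\<integral>z. trunc_gauss A v z \<partial>lborel)"
proof -
  show "0 \<le> gauss_cdf A v w"
    unfolding gauss_cdf_def
    by (intro integral_nonneg_AE AE_I2) (simp add: trunc_gauss_bounds[OF assms])
  show "gauss_cdf A v w \<le> (\<integral>z. trunc_gauss A v z \<partial>lborel)"
    unfolding gauss_cdf_def
    by (intro integral_mono integrable_trunc_gauss_restrict integrable_trunc_gauss assms)
      (simp_all add: trunc_gauss_bounds[OF assms])
qed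

text \<open>The density is even, so the value at \<open>- w\<close> is the mass above
  \<open>w\<close>. This is what carries negative shifts over to positive ones.\<close>

lemma gauss_cdf_symmetric:
  assumes "0 \<le> v"
  shows "gauss_cdf A v w + gauss_cdf A v (- w) = (\<integral>z. trunc_gauss A v z \<partial>lborel)"
proof -
  have "gauss_cdf A v (- w) = (\<integral>z. (if w \<le> z then trunc_gauss A v z else 0) \<partial>lborel)"
    unfolding gauss_cdf_def
    by (subst lborel_integral_real_affine[of "-1" _ 0]) (simp_all add: trunc_gauss_def cong: if_cong)
  then have "gauss_cdf A v w + gauss_cdf A v (- w) =
      (\<integral>z. (if z \<le> w then trunc_gauss A v z else 0) + (if w \<le> z then trunc_gauss A v z else 0) \<partial>lborel)"
    unfolding gauss_cdf_def
    using integrable_trunc_gauss_restrict[OF assms] by simp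
  also have "\<dots> = (\<integral>z. trunc_gauss A v z \<partial>lborel)"
  proof (rule integral_cong_AE)
    show "AE z in lborel. (if z \<le> w then trunc_gauss A v z else 0) + (if w \<le> z then trunc_gauss A v z else 0) =
        trunc_gauss A v z"
      using AE_lborel_singleton[of w] by eventually_elim simp
  qed measurable
  finally show ?thesis .
qed

text \<open>After the substitution \<open>z = s - u\<close> the first term integrates over
  \<open>u \<ge> x\<close> and the second over \<open>[-N, x]\<close>. Their sum does not depend on
  \<open>x\<close>, so in expectation the two terms vary oppositely.\<close>

lemma gauss_cdf_partial_integral:
  assumes "0 \<le> v" "- N \<le> x"
  shows "gauss_cdf A v (s - x) + partial_integral N (\<lambda>u. trunc_gauss A v (s - u)) x =
    (\<integral>u. (if - N \<le> u then trunc_gauss A v (s - u) else 0) \<partial>lborel)"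
proof -
  have int: "integrable lborel (\<lambda>u. if P u then trunc_gauss A v (s - u) else 0)"
    if [measurable]: "Measurable.pred borel P" for P
  proof -
    have "integrable lborel (\<lambda>z. if P (s - z) then trunc_gauss A v z else 0)"
      by (rule integrable_trunc_gauss_restrict[OF assms(1)]) measurable
    from lborel_integrable_real_affine[OF this, of "-1" s] show ?thesis by (simp cong: if_cong)
  qed
  have "gauss_cdf A v (s - x) = (\<integral>u. (if x \<le> u then trunc_gauss A v (s - u) else 0) \<partial>lborel)"
    unfolding gauss_cdf_def
    by (subst lborel_integral_real_affine[of "-1" _ s]) (simp_all cong: if_cong)
  then have "gauss_cdf A v (s - x) + partial_integral N (\<lambda>u. trunc_gauss A v (s - u)) x =
      (\<integral>u. (if x \<le> u then trunc_gauss A v (s - u) else 0) +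
        (if - N \<le> u \<and> u \<le> x then trunc_gauss A v (s - u) else 0) \<partial>lborel)"
    unfolding partial_integral_def by (simp add: int)
  also have "\<dots> = (\<integral>u. (if - N \<le> u then trunc_gauss A v (s - u) else 0) \<partial>lborel)"
  proof (rule integral_cong_AE)
    show "AE u in lborel. (if x \<le> u then trunc_gauss A v (s - u) else 0) +
        (if - N \<le> u \<and> u \<le> x then trunc_gauss A v (s - u) else 0) =
        (if - N \<le> u then trunc_gauss A v (s - u) else 0)"
      using AE_lborel_singleton[of x] by eventually_elim (use assms(2) in simp)
  qed measurable
  finally show ?thesis .
qed

subsection \<open>Comparison of expectations\<close>

context prob_space
begin

lemma AE_interval_nonempty:
  assumes "AE \<omega> in M. a \<le> X \<omega>" "AE \<omega> in M. X \<omega> \<le> (b :: real)"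
  shows "a \<le> b"
proof -
  have "AE \<omega> in M. a \<le> b" using assms by eventually_elim simp
  then show ?thesis by simp
qed

lemma integrable_exp_bounded:
  fixes Z :: "'a \<Rightarrow> real" and N t :: real
  assumes [measurable]: "Z \<in> borel_measurable M" and Z: "AE \<omega> in M. \<bar>Z \<omega>\<bar> \<le> N"
  shows "integrable M (\<lambda>\<omega>. exp (t * Z \<omega>))" "integrable M Z"
proof -
  show "integrable M (\<lambda>\<omega>. exp (t * Z \<omega>))"
  proof (rule integrable_const_bound[of _ "exp (\<bar>t\<bar> * N)"])
    show "AE \<omega> in M. norm (exp (t * Z \<omega>)) \<le> exp (\<bar>t\<bar> * N)"
      using Z
    proof eventually_elim
      case (elim \<omega>)
      have "t * Z \<omega> \<le> \<bar>t\<bar> * \<bar>Z \<omega>\<bar>" by (simp flip: abs_mult)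
      also have "\<dots> \<le> \<bar>t\<bar> * N" using elim by (intro mult_left_mono) simp_all
      finally show ?case by simp
    qed
  qed measurable
  show "integrable M Z"
    by (rule integrable_const_bound[of _ N]) (use Z in simp_all)
qed

lemma partial_integral_integrable:
  assumes [measurable]: "k \<in> borel_measurable borel" "X \<in> borel_measurable M"
    and bd: "\<And>u. \<bar>u\<bar> \<le> N \<Longrightarrow> \<bar>k u\<bar> \<le> C" and X: "AE \<omega> in M. \<bar>X \<omega>\<bar> \<le> N" and N: "0 \<le> N"
  shows "integrable M (\<lambda>\<omega>. partial_integral N k (X \<omega>))"
proof (rule integrable_const_bound[of _ "2 * N * C"])
  have C: "0 \<le> C" using bd[of 0] N by simp
  \<comment> \<open>The size of the partial integral is obtained as its distance from that of the
    zero kernel.\<close>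
  have "\<bar>partial_integral N k x - partial_integral N (\<lambda>u. 0) x\<bar> \<le> 2 * N * C" if "x \<le> N" for x
    by (rule partial_integral_diff_le[where C = C and C' = 0]) (use bd N C that in simp_all)
  then have "\<bar>partial_integral N k x\<bar> \<le> 2 * N * C" if "x \<le> N" for x
    using that by (simp add: partial_integral_def)
  then show "AE \<omega> in M. norm (partial_integral N k (X \<omega>)) \<le> 2 * N * C"
    using X by (auto elim!: eventually_mono)
qed measurable

lemma expectation_partial_integral_diff_le:
  assumes [measurable]: "k \<in> borel_measurable borel" "k' \<in> borel_measurable borel"
      "X \<in> borel_measurable M"
    and bd: "\<And>u. \<bar>u\<bar> \<le> N \<Longrightarrow> \<bar>k u\<bar> \<le> C" "\<And>u. \<bar>u\<bar> \<le> N \<Longrightarrow> \<bar>k' u\<bar> \<le> C'"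
    and X: "AE \<omega> in M. \<bar>X \<omega>\<bar> \<le> N" and N: "0 \<le> N"
    and diff: "\<And>u. \<bar>u\<bar> \<le> N \<Longrightarrow> \<bar>k u - k' u\<bar> \<le> e"
  shows "\<bar>expectation (\<lambda>\<omega>. partial_integral N k (X \<omega>)) -
    expectation (\<lambda>\<omega>. partial_integral N k' (X \<omega>))\<bar> \<le> 2 * N * e"
proof -
  let ?f = "\<lambda>\<omega>. partial_integral N k (X \<omega>)" and ?g = "\<lambda>\<omega>. partial_integral N k' (X \<omega>)"
  have int: "integrable M ?f" "integrable M ?g"
    by (rule partial_integral_integrable[OF _ _ bd(1) X N] partial_integral_integrable[OF _ _ bd(2) X N];
        measurable)+
  have e: "0 \<le> e" using diff[of 0] N by simp
  have "AE \<omega> in M. \<bar>?f \<omega> - ?g \<omega>\<bar> \<le> 2 * N * e"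
    using X
  proof eventually_elim
    case (elim \<omega>)
    then show ?case by (intro partial_integral_diff_le[OF _ _ bd diff _ N e]) simp_all
  qed
  then have "expectation (\<lambda>\<omega>. \<bar>?f \<omega> - ?g \<omega>\<bar>) \<le> expectation (\<lambda>\<omega>. 2 * N * e)"
    by (intro integral_mono_AE integrable_abs Bochner_Integration.integrable_diff int) simp_all
  moreover have "\<bar>expectation (\<lambda>\<omega>. ?f \<omega> - ?g \<omega>)\<bar> \<le> expectation (\<lambda>\<omega>. \<bar>?f \<omega> - ?g \<omega>\<bar>)"
    by (rule integral_abs_bound)
  moreover have "expectation (\<lambda>\<omega>. ?f \<omega> - ?g \<omega>) = expectation ?f - expectation ?g"
    using int by (rule Bochner_Integration.integral_diff)
  ultimately show ?thesis by (simp add: prob_space)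
qed

end

text \<open>Everything needed for \<open>s \<ge> 0\<close>, stated so that it can be instantiated
  both with \<open>X\<close>, \<open>Y\<close> and with \<open>- Y\<close>, \<open>- X\<close>. The
  reals \<open>b\<close> and \<open>c\<close> separate the essential maxima; the essential minima
  enter as the maxima of the second instance.\<close>

locale right_dominance = prob_space +
  fixes X Y :: "'a \<Rightarrow> real" and N b c :: real
  assumes X_meas [measurable]: "X \<in> borel_measurable M" and Y_meas [measurable]: "Y \<in> borel_measurable M"
    and N_pos: "0 < N"
    and X_bounded: "AE \<omega> in M. \<bar>X \<omega>\<bar> \<le> N" and Y_bounded: "AE \<omega> in M. \<bar>Y \<omega>\<bar> \<le> N"
    and mean_less: "expectation Y < expectation X"
    and exp_pos_less: "\<And>t. 0 < t \<Longrightarrow> expectation (\<lambda>\<omega>. exp (t * Y \<omega>)) < expectation (\<lambda>\<omega>. exp (t * X \<omega>))"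
    and exp_neg_less: "\<And>t. t < 0 \<Longrightarrow> expectation (\<lambda>\<omega>. exp (t * X \<omega>)) < expectation (\<lambda>\<omega>. exp (t * Y \<omega>))"
    and Y_le: "AE \<omega> in M. Y \<omega> \<le> b" and b_less_c: "b < c"
    and X_ge_c: "0 < prob {\<omega> \<in> space M. c \<le> X \<omega>}"
begin

lemma minus_N_le_b: "- N \<le> b"
proof (rule AE_interval_nonempty)
  show "AE \<omega> in M. - N \<le> Y \<omega>" using Y_bounded by eventually_elim simp
qed (rule Y_le)

lemma c_le_N: "c \<le> N"
proof (rule ccontr)
  assume "\<not> c \<le> N"
  then have "AE \<omega> in M. \<not> c \<le> X \<omega>" using X_bounded by (auto elim!: eventually_mono)
  then have "prob {\<omega> \<in> space M. c \<le> X \<omega>} = 0" by (subst prob_Collect_eq_0) measurable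
  then show False using X_ge_c by simp
qed

lemma expectation_partial_integral_exp:
  assumes [measurable]: "Z \<in> borel_measurable M" and Z: "AE \<omega> in M. \<bar>Z \<omega>\<bar> \<le> N"
  shows "expectation (\<lambda>\<omega>. partial_integral N (\<lambda>u. exp (t * u)) (Z \<omega>)) =
    (if t = 0 then expectation Z + N else (expectation (\<lambda>\<omega>. exp (t * Z \<omega>)) - exp (- t * N)) / t)"
proof -
  have "expectation (\<lambda>\<omega>. partial_integral N (\<lambda>u. exp (t * u)) (Z \<omega>)) =
      expectation (\<lambda>\<omega>. if t = 0 then Z \<omega> + N else (exp (t * Z \<omega>) - exp (- t * N)) / t)"
  proof (rule integral_cong_AE)
    show "AE \<omega> in M. partial_integral N (\<lambda>u. exp (t * u)) (Z \<omega>) =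
        (if t = 0 then Z \<omega> + N else (exp (t * Z \<omega>) - exp (- t * N)) / t)"
      using Z by eventually_elim (rule partial_integral_exp, simp add: abs_le_iff)
  qed measurable
  also have "\<dots> = (if t = 0 then expectation Z + N else (expectation (\<lambda>\<omega>. exp (t * Z \<omega>)) - exp (- t * N)) / t)"
    using integrable_exp_bounded[OF assms] by (cases "t = 0") (simp_all add: prob_space)
  finally show ?thesis .
qed

definition gap :: "(real \<Rightarrow> real) \<Rightarrow> real" where
  "gap k = expectation (\<lambda>\<omega>. partial_integral N k (X \<omega>)) - expectation (\<lambda>\<omega>. partial_integral N k (Y \<omega>))"

text \<open>The contributions of the lower limit \<open>- N\<close> cancel in the difference. For
  negative \<open>t\<close> the reversed inequality of the exponential moments is undone by the
  division by \<open>t\<close>.\<close>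

lemma gap_exp_pos: "0 < gap (\<lambda>u. exp (t * u))"
proof -
  consider "t = 0" | "0 < t" | "t < 0" by linarith
  then show ?thesis
  proof cases
    case 1
    then show ?thesis
      unfolding gap_def expectation_partial_integral_exp[OF X_meas X_bounded]
        expectation_partial_integral_exp[OF Y_meas Y_bounded]
      using mean_less by simp
  next
    case 2
    then show ?thesis
      unfolding gap_def expectation_partial_integral_exp[OF X_meas X_bounded]
        expectation_partial_integral_exp[OF Y_meas Y_bounded]
      using exp_pos_less[OF 2] by (simp add: divide_strict_right_mono)
  next
    case 3
    then show ?thesis
      unfolding gap_def expectation_partial_integral_exp[OF X_meas X_bounded]
        expectation_partial_integral_exp[OF Y_meas Y_bounded]
      using exp_neg_less[OF 3] by (simp add: divide_strict_right_mono_neg)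
  qed
qed

lemma gap_diff_le:
  assumes "k \<in> borel_measurable borel" "k' \<in> borel_measurable borel"
    and "\<And>u. \<bar>u\<bar> \<le> N \<Longrightarrow> \<bar>k u\<bar> \<le> C" "\<And>u. \<bar>u\<bar> \<le> N \<Longrightarrow> \<bar>k' u\<bar> \<le> C'"
    and "\<And>u. \<bar>u\<bar> \<le> N \<Longrightarrow> \<bar>k u - k' u\<bar> \<le> e"
  shows "\<bar>gap k - gap k'\<bar> \<le> 4 * N * e"
  using expectation_partial_integral_diff_le[OF assms(1,2) X_meas assms(3,4) X_bounded less_imp_le[OF N_pos] assms(5)]
    expectation_partial_integral_diff_le[OF assms(1,2) Y_meas assms(3,4) Y_bounded less_imp_le[OF N_pos] assms(5)]
  unfolding gap_def by linarith

lemma gap_exp_bounded_below: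
  assumes "0 \<le> T"
  obtains d where "0 < d" "\<And>t. \<bar>t\<bar> \<le> T \<Longrightarrow> d \<le> gap (\<lambda>u. exp (t * u))"
proof -
  \<comment> \<open>A Lipschitz constant in \<open>t\<close>: \<open>4 * N\<close> for two
    expectations over an interval of length \<open>2 * N\<close>, \<open>exp (T * N)\<close> for the
    slope of the exponential, and \<open>N\<close> for the factor \<open>u\<close> in the
    exponent.\<close>
  define L where "L = 4 * N * (exp (T * N) * N)"
  have tu: "\<bar>t * u\<bar> \<le> T * N" if "\<bar>t\<bar> \<le> T" "\<bar>u\<bar> \<le> N" for t u
    unfolding abs_mult using that assms by (intro mult_mono) simp_all
  have lip: "\<bar>gap (\<lambda>u. exp (t * u)) - gap (\<lambda>u. exp (t' * u))\<bar> \<le> L * \<bar>t - t'\<bar>"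
    if t: "\<bar>t\<bar> \<le> T" "\<bar>t'\<bar> \<le> T" for t t'
  proof -
    have "\<bar>gap (\<lambda>u. exp (t * u)) - gap (\<lambda>u. exp (t' * u))\<bar> \<le> 4 * N * (exp (T * N) * (N * \<bar>t - t'\<bar>))"
    proof (rule gap_diff_le)
      fix u assume u: "\<bar>u\<bar> \<le> N"
      show "\<bar>exp (t * u)\<bar> \<le> exp (T * N)" using tu[OF t(1) u] by simp
      show "\<bar>exp (t' * u)\<bar> \<le> exp (T * N)" using tu[OF t(2) u] by simp
      have "\<bar>exp (t * u) - exp (t' * u)\<bar> \<le> exp (T * N) * \<bar>t * u - t' * u\<bar>"
        by (rule exp_diff_le[OF tu[OF t(1) u] tu[OF t(2) u]])
      also have "\<bar>t * u - t' * u\<bar> = \<bar>u\<bar> * \<bar>t - t'\<bar>" by (simp flip: abs_mult add: algebra_simps)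
      also have "exp (T * N) * (\<bar>u\<bar> * \<bar>t - t'\<bar>) \<le> exp (T * N) * (N * \<bar>t - t'\<bar>)"
        using u by (intro mult_left_mono mult_right_mono) simp_all
      finally show "\<bar>exp (t * u) - exp (t' * u)\<bar> \<le> exp (T * N) * (N * \<bar>t - t'\<bar>)" .
    qed measurable
    then show ?thesis by (simp add: L_def mult_ac)
  qed
  have "0 \<le> L" using N_pos by (simp add: L_def)
  have "continuous_on {- T..T} (\<lambda>t. gap (\<lambda>u. exp (t * u)))"
  proof (rule lipschitz_on_continuous_on[where L = L], rule lipschitz_onI)
    fix t t' assume "t \<in> {- T..T}" "t' \<in> {- T..T}"
    then have "\<bar>t\<bar> \<le> T" "\<bar>t'\<bar> \<le> T" by auto
    from lip[OF this]
    show "dist (gap (\<lambda>u. exp (t * u))) (gap (\<lambda>u. exp (t' * u))) \<le> L * dist t t'"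
      by (simp add: dist_real_def)
  qed (rule \<open>0 \<le> L\<close>)
  then obtain t0 where t0: "\<And>t. t \<in> {- T..T} \<Longrightarrow> gap (\<lambda>u. exp (t0 * u)) \<le> gap (\<lambda>u. exp (t * u))"
    using continuous_attains_inf[of "{- T..T}" "\<lambda>t. gap (\<lambda>u. exp (t * u))"] assms
    by (metis atLeastAtMost_iff compact_Icc empty_iff neg_le_0_iff_le)
  show thesis
  proof (rule that[OF gap_exp_pos[of t0]])
    fix t :: real assume "\<bar>t\<bar> \<le> T"
    then show "gap (\<lambda>u. exp (t0 * u)) \<le> gap (\<lambda>u. exp (t * u))" by (intro t0) (simp add: abs_le_iff)
  qed
qed

lemma gap_gauss_nonneg:
  assumes "0 \<le> T"
  obtains v0 where "0 < v0" "v0 \<le> 1"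
    "\<And>v t. 0 < v \<Longrightarrow> v \<le> v0 \<Longrightarrow> \<bar>t\<bar> \<le> T \<Longrightarrow> 0 \<le> gap (\<lambda>u. exp (t * u - v * u\<^sup>2))"
proof -
  obtain d where d: "0 < d" "\<And>t. \<bar>t\<bar> \<le> T \<Longrightarrow> d \<le> gap (\<lambda>u. exp (t * u))"
    using gap_exp_bounded_below[OF assms] by blast
  \<comment> \<open>Bounds the exponents with and without the quadratic term, given
    \<open>v \<le> 1\<close>.\<close>
  define B where "B = T * N + N\<^sup>2"
  define L where "L = 4 * N * (exp B * N\<^sup>2)"
  have L: "0 < L" using N_pos by (simp add: L_def)
  \<comment> \<open>The quadratic term changes the gap by at most \<open>L * v\<close>, which must
    not exceed the margin \<open>d\<close>.\<close>
  define v0 where "v0 = min 1 (d / L)"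
  show thesis
  proof (rule that)
    show "0 < v0" "v0 \<le> 1" using d L by (simp_all add: v0_def)
    fix v t :: real assume v: "0 < v" "v \<le> v0" and t: "\<bar>t\<bar> \<le> T"
    have "v \<le> 1" using v by (simp add: v0_def)
    have "\<bar>gap (\<lambda>u. exp (t * u - v * u\<^sup>2)) - gap (\<lambda>u. exp (t * u))\<bar> \<le> 4 * N * (exp B * (v * N\<^sup>2))"
    proof (rule gap_diff_le)
      fix u assume u: "\<bar>u\<bar> \<le> N"
      have tu: "\<bar>t * u\<bar> \<le> T * N" unfolding abs_mult using t u assms by (intro mult_mono) simp_all
      have u2: "u\<^sup>2 \<le> N\<^sup>2" using u N_pos by (simp add: abs_le_square_iff[symmetric])
      then have vu: "v * u\<^sup>2 \<le> v * N\<^sup>2" using v by (intro mult_left_mono) simp_all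
      have "v * N\<^sup>2 \<le> N\<^sup>2" using \<open>v \<le> 1\<close> by (simp add: mult_left_le_one_le v(1) less_imp_le)
      moreover have "0 \<le> v * u\<^sup>2" "0 \<le> N\<^sup>2" using v by simp_all
      ultimately have B: "\<bar>t * u - v * u\<^sup>2\<bar> \<le> B" "\<bar>t * u\<bar> \<le> B"
        using tu vu unfolding B_def by linarith+
      show "\<bar>exp (t * u - v * u\<^sup>2)\<bar> \<le> exp B" "\<bar>exp (t * u)\<bar> \<le> exp B" using B by simp_all
      have "\<bar>exp (t * u - v * u\<^sup>2) - exp (t * u)\<bar> \<le> exp B * \<bar>t * u - v * u\<^sup>2 - t * u\<bar>"
        by (rule exp_diff_le[OF B])
      also have "\<bar>t * u - v * u\<^sup>2 - t * u\<bar> = v * u\<^sup>2" using \<open>0 \<le> v * u\<^sup>2\<close> by simp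
      also have "exp B * (v * u\<^sup>2) \<le> exp B * (v * N\<^sup>2)" by (rule mult_left_mono[OF vu]) simp
      finally show "\<bar>exp (t * u - v * u\<^sup>2) - exp (t * u)\<bar> \<le> exp B * (v * N\<^sup>2)" .
    qed measurable
    also have "\<dots> = L * v" by (simp add: L_def mult_ac)
    also have "\<dots> \<le> d" using v L by (simp add: v0_def field_simps)
    finally show "0 \<le> gap (\<lambda>u. exp (t * u - v * u\<^sup>2))" using d(2)[OF t] by linarith
  qed
qed

text \<open>The partial integral \<open>J\<close> of the kernel is nonnegative and increasing, so
  its expectation is at most \<open>J b\<close> for \<open>Y\<close> and at least
  \<open>p * J c\<close> for \<open>X\<close>. It suffices that \<open>J b \<le> p * J c\<close>,
  which holds for large \<open>t\<close> because the kernel on the upper half of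
  \<open>[b, c]\<close> outweighs exponentially all that lies below \<open>b\<close>. The threshold
  does not depend on the cut \<open>a\<close>.\<close>

lemma gap_tail_nonneg:
  obtains T where "0 \<le> T"
    "\<And>t v a. T \<le> t \<Longrightarrow> 0 \<le> v \<Longrightarrow> v \<le> 1 \<Longrightarrow> 0 \<le> gap (\<lambda>u. if a \<le> u then exp (t * u - v * u\<^sup>2) else 0)"
proof -
  define p where "p = prob {\<omega> \<in> space M. c \<le> X \<omega>}"
  have p: "0 < p" using X_ge_c by (simp add: p_def)
  define m where "m = (b + c) / 2"
  have m: "b < m" "m < c" using b_less_c by (simp_all add: m_def)
  \<comment> \<open>Solves \<open>T * (m - b) * (p * (c - m)) = (b + N) * exp (N\<^sup>2)\<close>.
    Using \<open>x \<le> exp x\<close> in place of a logarithm makes this value sufficient.\<close>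
  define T where "T = (b + N) * exp (N\<^sup>2) / (p * (c - m)) / (m - b)"
  have bN: "0 \<le> b + N" using minus_N_le_b by simp
  show thesis
  proof (rule that)
    show T0: "0 \<le> T" using bN p m by (simp add: T_def)
    fix t v a :: real assume t: "T \<le> t" and v: "0 \<le> v" "v \<le> 1"
    define k where "k u = (if a \<le> u then exp (t * u - v * u\<^sup>2) else 0)" for u
    have k_meas [measurable]: "k \<in> borel_measurable borel" unfolding k_def by measurable
    have t0: "0 \<le> t" using T0 t by simp
    have k0: "0 \<le> k u" for u by (simp add: k_def)
    have k_le: "k u \<le> exp (t * y)" if "u \<le> y" for u y
    proof -
      have "t * u - v * u\<^sup>2 \<le> t * y" using mult_left_mono[OF that t0] v(1) by (smt (verit) mult_nonneg_nonneg zero_le_power2)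
      then show ?thesis by (simp add: k_def)
    qed
    have k_bd: "\<bar>k u\<bar> \<le> exp (t * N)" if "\<bar>u\<bar> \<le> N" for u
      using k_le[of u N] k0[of u] that by simp
    let ?J = "partial_integral N k"
    have mono: "?J x \<le> ?J y" if "x \<le> y" "y \<le> N" for x y
      by (rule partial_integral_mono[OF k_meas k_bd k0 that])
    have int: "integrable M (\<lambda>\<omega>. ?J (Z \<omega>))"
      if "Z \<in> borel_measurable M" "AE \<omega> in M. \<bar>Z \<omega>\<bar> \<le> N" for Z
      by (rule partial_integral_integrable[OF k_meas that(1) k_bd that(2) less_imp_le[OF N_pos]])
    have J0: "0 \<le> ?J x" for x by (rule partial_integral_nonneg[OF k0])
    \<comment> \<open>A cut above \<open>b\<close> removes the kernel on all of
      \<open>[-N, b]\<close>, so the left side vanishes. A cut at or below \<open>b\<close> leaves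
      \<open>[m, c]\<close> untouched, and the mass there is compared with that of
      \<open>[-N, b]\<close>.\<close>
    have bound: "?J b \<le> p * ?J c"
    proof (cases "a \<le> b")
      case False
      then have "?J b = partial_integral N (\<lambda>u. 0) b" by (intro partial_integral_cong) (simp add: k_def)
      then have "?J b = 0" by (simp add: partial_integral_def)
      then show ?thesis using p J0[of c] by simp
    next
      case True
      have ind: "integrable lborel (\<lambda>u. e * indicator {x..y} u :: real)"
          "(\<integral>u. e * indicator {x..y} u \<partial>lborel) = e * (y - x)" if "x \<le> y" for e x y :: real
        using that by simp_all
      have pint: "integrable lborel (\<lambda>u. if - N \<le> u \<and> u \<le> x then k u else 0)" if "x \<le> N" for x
        by (rule partial_integrable[OF k_meas k_bd that])
      have "?J b \<le> (\<integral>u. exp (t * b) * indicator {- N..b} u \<partial>lborel)"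
        unfolding partial_integral_def
      proof (rule integral_mono)
        show "integrable lborel (\<lambda>u. if - N \<le> u \<and> u \<le> b then k u else 0)"
          using b_less_c c_le_N by (intro pint) simp
        show "(if - N \<le> u \<and> u \<le> b then k u else 0) \<le> exp (t * b) * indicator {- N..b} u" for u
          using k_le[of u b] by (simp add: indicator_def)
      qed (rule ind(1)[OF minus_N_le_b])
      also have "\<dots> = exp (t * b) * (b + N)"
        using ind(2)[OF minus_N_le_b, of "exp (t * b)"] unfolding diff_minus_eq_add .
      finally have upper: "?J b \<le> exp (t * b) * (b + N)" .
      have "exp (t * m - N\<^sup>2) * (c - m) = (\<integral>u. exp (t * m - N\<^sup>2) * indicator {m..c} u \<partial>lborel)"
        using ind(2)[of m c] m by simp
      also have "\<dots> \<le> ?J c"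
        unfolding partial_integral_def
      proof (rule integral_mono)
        show "integrable lborel (\<lambda>u. if - N \<le> u \<and> u \<le> c then k u else 0)"
          using c_le_N by (intro pint)
        show "exp (t * m - N\<^sup>2) * indicator {m..c} u \<le> (if - N \<le> u \<and> u \<le> c then k u else 0)" for u
        proof (cases "u \<in> {m..c}")
          case u: True
          then have uN: "- N \<le> u" "u \<le> N" using minus_N_le_b c_le_N m by auto
          then have "u\<^sup>2 \<le> N\<^sup>2" using N_pos by (simp add: abs_le_square_iff[symmetric] abs_le_iff)
          then have "v * u\<^sup>2 \<le> N\<^sup>2" using v by (smt (verit) mult_left_le_one_le zero_le_power2)
          moreover have "t * m \<le> t * u" using u t0 by (intro mult_left_mono) simp_all
          ultimately have "exp (t * m - N\<^sup>2) \<le> exp (t * u - v * u\<^sup>2)" by simp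
          then show ?thesis using u uN True m by (simp add: k_def)
        next
          case False
          then show ?thesis using k0[of u] by simp
        qed
      qed (rule ind(1), use m in simp)
      finally have lower: "exp (t * m - N\<^sup>2) * (c - m) \<le> ?J c" .
      have "(b + N) * exp (N\<^sup>2) / (p * (c - m)) = T * (m - b)" using m by (simp add: T_def)
      also have "\<dots> \<le> t * (m - b)" using t m by (intro mult_right_mono) simp_all
      also have "\<dots> \<le> exp (t * (m - b))" using exp_ge_add_one_self[of "t * (m - b)"] by linarith
      finally have "(b + N) * exp (N\<^sup>2) \<le> exp (t * (m - b)) * (p * (c - m))"
        using p m by (simp add: divide_le_eq)
      then have "exp (t * b - N\<^sup>2) * ((b + N) * exp (N\<^sup>2)) \<le> exp (t * b - N\<^sup>2) * (exp (t * (m - b)) * (p * (c - m)))"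
        by (intro mult_left_mono) simp_all
      moreover have "exp (t * b - N\<^sup>2) * ((b + N) * exp (N\<^sup>2)) = exp (t * b) * (b + N)"
        by (simp add: exp_diff)
      moreover have "exp (t * b - N\<^sup>2) * exp (t * (m - b)) = exp (t * m - N\<^sup>2)"
        by (simp add: algebra_simps flip: exp_add)
      then have "exp (t * b - N\<^sup>2) * (exp (t * (m - b)) * (p * (c - m))) = p * (exp (t * m - N\<^sup>2) * (c - m))"
        by (simp add: mult.assoc[symmetric])
      ultimately have "exp (t * b) * (b + N) \<le> p * (exp (t * m - N\<^sup>2) * (c - m))" by simp
      also have "\<dots> \<le> p * ?J c" using lower p by (intro mult_left_mono) simp_all
      finally show ?thesis using upper by simp
    qed
    have "expectation (\<lambda>\<omega>. ?J (Y \<omega>)) \<le> expectation (\<lambda>\<omega>. ?J b)"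
    proof (rule integral_mono_AE)
      show "AE \<omega> in M. ?J (Y \<omega>) \<le> ?J b"
        using Y_le
      proof eventually_elim
        case (elim \<omega>)
        then show ?case using b_less_c c_le_N by (intro mono) simp_all
      qed
    qed (simp_all add: int[OF Y_meas Y_bounded])
    also have "\<dots> = ?J b" by (simp add: prob_space)
    also note bound
    also have "p * ?J c = expectation (\<lambda>\<omega>. indicator {\<omega> \<in> space M. c \<le> X \<omega>} \<omega> * ?J c)"
      by (simp add: p_def)
    also have "\<dots> \<le> expectation (\<lambda>\<omega>. ?J (X \<omega>))"
    proof (rule integral_mono_AE)
      show "AE \<omega> in M. indicator {\<omega> \<in> space M. c \<le> X \<omega>} \<omega> * ?J c \<le> ?J (X \<omega>)"
        using X_bounded
      proof eventually_elim
        case (elim \<omega>)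
        then have "X \<omega> \<le> N" by linarith
        then show ?case using mono[of c "X \<omega>"] J0[of "X \<omega>"] by (simp add: indicator_def)
      qed
      show "integrable M (\<lambda>\<omega>. indicator {\<omega> \<in> space M. c \<le> X \<omega>} \<omega> * ?J c)"
        by (intro integrable_mult_left integrable_real_indicator) (simp_all add: emeasure_eq_measure)
    qed (simp_all add: int[OF X_meas X_bounded])
    finally show "0 \<le> gap (\<lambda>u. if a \<le> u then exp (t * u - v * u\<^sup>2) else 0)"
      unfolding gap_def k_def by simp
  qed
qed

lemma gap_cong:
  assumes "k \<in> borel_measurable borel" "k' \<in> borel_measurable borel"
    and eq: "\<And>u. \<bar>u\<bar> \<le> N \<Longrightarrow> k u = k' u"
  shows "gap k = gap k'"
proof -
  have "expectation (\<lambda>\<omega>. partial_integral N k (Z \<omega>)) = expectation (\<lambda>\<omega>. partial_integral N k' (Z \<omega>))"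
    if [measurable]: "Z \<in> borel_measurable M" and Z: "AE \<omega> in M. \<bar>Z \<omega>\<bar> \<le> N" for Z
  proof (rule integral_cong_AE)
    show "AE \<omega> in M. partial_integral N k (Z \<omega>) = partial_integral N k' (Z \<omega>)"
      using Z by eventually_elim (intro partial_integral_cong eq, linarith)
  qed (use assms in measurable)
  from this[OF X_meas X_bounded] this[OF Y_meas Y_bounded] show ?thesis by (simp add: gap_def)
qed

lemma gap_cmult: "gap (\<lambda>u. a * k u) = a * gap k"
  by (simp add: gap_def partial_integral_cmult right_diff_distrib)

lemma gauss_cdf_expectation_le:
  assumes v: "0 \<le> v" and gap: "0 \<le> gap (\<lambda>u. trunc_gauss A v (s - u))"
  shows "expectation (\<lambda>\<omega>. gauss_cdf A v (s - X \<omega>)) \<le> expectation (\<lambda>\<omega>. gauss_cdf A v (s - Y \<omega>))"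
proof -
  define c where "c = (\<integral>u. (if - N \<le> u then trunc_gauss A v (s - u) else 0) \<partial>lborel)"
  let ?J = "partial_integral N (\<lambda>u. trunc_gauss A v (s - u))"
  have "expectation (\<lambda>\<omega>. gauss_cdf A v (s - Z \<omega>)) = c - expectation (\<lambda>\<omega>. ?J (Z \<omega>))"
    if [measurable]: "Z \<in> borel_measurable M" and Z: "AE \<omega> in M. \<bar>Z \<omega>\<bar> \<le> N" for Z
  proof -
    have int: "integrable M (\<lambda>\<omega>. ?J (Z \<omega>))"
      by (rule partial_integral_integrable[OF _ _ trunc_gauss_bounds(2)[OF v] Z less_imp_le[OF N_pos]])
        measurable
    have "expectation (\<lambda>\<omega>. gauss_cdf A v (s - Z \<omega>)) = expectation (\<lambda>\<omega>. c - ?J (Z \<omega>))"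
    proof (rule integral_cong_AE)
      show "AE \<omega> in M. gauss_cdf A v (s - Z \<omega>) = c - ?J (Z \<omega>)"
        using Z
      proof eventually_elim
        case (elim \<omega>)
        then have "- N \<le> Z \<omega>" by linarith
        from gauss_cdf_partial_integral[OF v this, of A s] show ?case unfolding c_def by linarith
      qed
    qed measurable
    also have "\<dots> = c - expectation (\<lambda>\<omega>. ?J (Z \<omega>))"
      using int by (simp add: prob_space)
    finally show ?thesis .
  qed
  from this[OF X_meas X_bounded] this[OF Y_meas Y_bounded] gap show ?thesis
    unfolding gap_def by linarith
qed

text \<open>Stated for all smaller \<open>v\<close> and all larger \<open>A\<close>, so that the two
  reflected instances can share their parameters.\<close>

lemma gauss_dominance_right:
  obtains T v0 where "0 \<le> T" "0 < v0"
    "\<And>v A s. 0 < v \<Longrightarrow> v \<le> v0 \<Longrightarrow> N + T / (2 * v) \<le> A \<Longrightarrow> 0 \<le> s \<Longrightarrow>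
      expectation (\<lambda>\<omega>. gauss_cdf A v (s - X \<omega>)) \<le> expectation (\<lambda>\<omega>. gauss_cdf A v (s - Y \<omega>))"
proof -
  obtain T where T: "0 \<le> T"
    "\<And>t v a. T \<le> t \<Longrightarrow> 0 \<le> v \<Longrightarrow> v \<le> 1 \<Longrightarrow> 0 \<le> gap (\<lambda>u. if a \<le> u then exp (t * u - v * u\<^sup>2) else 0)"
    using gap_tail_nonneg by blast
  obtain v0 where v0: "0 < v0" "v0 \<le> 1"
    "\<And>v t. 0 < v \<Longrightarrow> v \<le> v0 \<Longrightarrow> \<bar>t\<bar> \<le> T \<Longrightarrow> 0 \<le> gap (\<lambda>u. exp (t * u - v * u\<^sup>2))"
    using gap_gauss_nonneg[OF T(1)] by blast
  show thesis
  proof (rule that[OF T(1) v0(1)])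
    fix v A s :: real assume v: "0 < v" "v \<le> v0" and A: "N + T / (2 * v) \<le> A" and s: "0 \<le> s"
    define t where "t = 2 * v * s"
    define k where "k u = (if s - A \<le> u then exp (t * u - v * u\<^sup>2) else 0)" for u
    have k_meas [measurable]: "k \<in> borel_measurable borel" unfolding k_def by measurable
    have "0 \<le> t" using v s by (simp add: t_def)
    have "0 \<le> T / (2 * v)" using T(1) v by simp
    then have "N \<le> A" using A by linarith
    have "0 \<le> gap k"
    proof (cases "T \<le> t")
      case True
      then show ?thesis unfolding k_def using v v0(2) by (intro T(2)) simp_all
    next
      case False
      \<comment> \<open>Below the threshold \<open>s\<close> is so small that the cut
        \<open>s - A\<close> lies at or below \<open>- N\<close>, and the kernel on
        \<open>[-N, N]\<close> is the full Gaussian one.\<close>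
      then have "s \<le> T / (2 * v)" using v by (simp add: t_def field_simps)
      then have sA: "s - A \<le> - N" using A by linarith
      have "gap k = gap (\<lambda>u. exp (t * u - v * u\<^sup>2))"
      proof (rule gap_cong)
        fix u assume "\<bar>u\<bar> \<le> N"
        then have "s - A \<le> u" using sA by linarith
        then show "k u = exp (t * u - v * u\<^sup>2)" by (simp add: k_def)
      qed measurable
      moreover have "0 \<le> gap (\<lambda>u. exp (t * u - v * u\<^sup>2))"
        using False \<open>0 \<le> t\<close> by (intro v0(3) v) simp
      ultimately show ?thesis by simp
    qed
    moreover have "gap (\<lambda>u. trunc_gauss A v (s - u)) = gap (\<lambda>u. exp (- (v * s\<^sup>2)) * k u)"
    proof (rule gap_cong)
      fix u assume "\<bar>u\<bar> \<le> N"
      \<comment> \<open>Only one end of the truncation is ever felt: \<open>u \<le> s + A\<close>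
        holds automatically because \<open>0 \<le> s\<close> and \<open>N \<le> A\<close>.\<close>
      then have "\<bar>s - u\<bar> \<le> A \<longleftrightarrow> s - A \<le> u" using s \<open>N \<le> A\<close> by linarith
      moreover have "exp (- (v * (s - u)\<^sup>2)) = exp (- (v * s\<^sup>2)) * exp (t * u - v * u\<^sup>2)"
        by (simp add: t_def power2_eq_square algebra_simps flip: exp_add)
      ultimately show "trunc_gauss A v (s - u) = exp (- (v * s\<^sup>2)) * k u"
        by (simp add: trunc_gauss_def k_def)
    qed measurable
    ultimately have "0 \<le> gap (\<lambda>u. trunc_gauss A v (s - u))"
      by (simp add: gap_cmult)
    then show "expectation (\<lambda>\<omega>. gauss_cdf A v (s - X \<omega>)) \<le> expectation (\<lambda>\<omega>. gauss_cdf A v (s - Y \<omega>))"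
      using v by (intro gauss_cdf_expectation_le) simp_all
  qed
qed

end

lemma (in prob_space) gauss_dominance:
  assumes XY: "right_dominance M X Y N b c"
    and neg: "right_dominance M (\<lambda>\<omega>. - Y \<omega>) (\<lambda>\<omega>. - X \<omega>) N b' c'"
  obtains A v where "0 < A" "0 < v"
    "\<And>s. expectation (\<lambda>\<omega>. gauss_cdf A v (s - X \<omega>)) \<le> expectation (\<lambda>\<omega>. gauss_cdf A v (s - Y \<omega>))"
proof -
  interpret XY: right_dominance M X Y N b c by (rule XY)
  interpret neg: right_dominance M "\<lambda>\<omega>. - Y \<omega>" "\<lambda>\<omega>. - X \<omega>" N b' c' by (rule neg)
  obtain T v0 where T: "0 \<le> T" "0 < v0"
    "\<And>v A s. 0 < v \<Longrightarrow> v \<le> v0 \<Longrightarrow> N + T / (2 * v) \<le> A \<Longrightarrow> 0 \<le> s \<Longrightarrow>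
      expectation (\<lambda>\<omega>. gauss_cdf A v (s - X \<omega>)) \<le> expectation (\<lambda>\<omega>. gauss_cdf A v (s - Y \<omega>))"
    using XY.gauss_dominance_right by blast
  obtain T' v0' where T': "0 \<le> T'" "0 < v0'"
    "\<And>v A s. 0 < v \<Longrightarrow> v \<le> v0' \<Longrightarrow> N + T' / (2 * v) \<le> A \<Longrightarrow> 0 \<le> s \<Longrightarrow>
      expectation (\<lambda>\<omega>. gauss_cdf A v (s - - Y \<omega>)) \<le> expectation (\<lambda>\<omega>. gauss_cdf A v (s - - X \<omega>))"
    using neg.gauss_dominance_right by blast
  define v where "v = min v0 v0'"
  define A where "A = N + max T T' / (2 * v)"
  have v: "0 < v" "v \<le> v0" "v \<le> v0'" using T(2) T'(2) by (simp_all add: v_def)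
  have A: "N + T / (2 * v) \<le> A" "N + T' / (2 * v) \<le> A"
    using v(1) unfolding A_def by (intro add_left_mono divide_right_mono; simp)+
  have "0 < A" using A(1) XY.N_pos T(1) v(1) by (smt (verit) divide_nonneg_pos)
  define tot where "tot = (\<integral>z. trunc_gauss A v z \<partial>lborel)"
  show thesis
  proof (rule that[OF \<open>0 < A\<close> v(1)])
    fix s
    show "expectation (\<lambda>\<omega>. gauss_cdf A v (s - X \<omega>)) \<le> expectation (\<lambda>\<omega>. gauss_cdf A v (s - Y \<omega>))"
    proof (cases "0 \<le> s")
      case True
      then show ?thesis by (rule T(3)[OF v(1,2) A(1)])
    next
      case False
      \<comment> \<open>Reflection of the noise: up to the constant \<open>tot\<close>, the shift
        \<open>s\<close> against \<open>Z\<close> is minus the shift \<open>- s\<close> against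
        \<open>- Z\<close>, so the inequality for the reflected pair returns in the wanted
        direction.\<close>
      have refl: "expectation (\<lambda>\<omega>. gauss_cdf A v (s - Z \<omega>)) =
          tot - expectation (\<lambda>\<omega>. gauss_cdf A v (- s - - Z \<omega>))"
        if [measurable]: "Z \<in> borel_measurable M" for Z
      proof -
        have "integrable M (\<lambda>\<omega>. gauss_cdf A v (- s - - Z \<omega>))"
          by (rule integrable_const_bound[of _ tot])
            (use v(1) gauss_cdf_bounds[of v A] in \<open>simp_all add: tot_def\<close>)
        moreover have "gauss_cdf A v (s - Z \<omega>) = tot - gauss_cdf A v (- s - - Z \<omega>)" for \<omega>
          using gauss_cdf_symmetric[of v A "s - Z \<omega>"] v(1) by (simp add: tot_def)
        ultimately show ?thesis by (simp add: prob_space)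
      qed
      have "expectation (\<lambda>\<omega>. gauss_cdf A v (- s - - Y \<omega>)) \<le> expectation (\<lambda>\<omega>. gauss_cdf A v (- s - - X \<omega>))"
        using False by (intro T'(3)[OF v(1,3) A(2)]) simp
      then show ?thesis using refl[OF XY.X_meas] refl[OF XY.Y_meas] by linarith
    qed
  qed
qed

section \<open>The law of the noise and sums with independent noise\<close>

definition gauss_measure :: "real \<Rightarrow> real \<Rightarrow> real measure" where
  "gauss_measure A v =
     density lborel (\<lambda>z. ennreal (trunc_gauss A v z / (\<integral>z. trunc_gauss A v z \<partial>lborel)))"

lemma trunc_gauss_integral_pos:
  assumes "0 < A" "0 \<le> v"
  shows "0 < (\<integral>z. trunc_gauss A v z \<partial>lborel)"
proof -
  have int: "integrable lborel (\<lambda>z. exp (- (v * A\<^sup>2)) * indicator {- A..A} z :: real)"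
    by (intro integrable_mult_right integrable_real_indicator) (simp_all add: emeasure_lborel_Icc_eq)
  have "0 < exp (- (v * A\<^sup>2)) * (2 * A)" using assms by simp
  also have "\<dots> = (\<integral>z. exp (- (v * A\<^sup>2)) * indicator {- A..A} z \<partial>lborel)"
    using assms by simp
  also have "\<dots> \<le> (\<integral>z. trunc_gauss A v z \<partial>lborel)"
  proof (rule integral_mono[OF int integrable_trunc_gauss[OF assms(2)]])
    fix z show "exp (- (v * A\<^sup>2)) * indicator {- A..A} z \<le> trunc_gauss A v z"
    proof (cases "\<bar>z\<bar> \<le> A")
      case True
      then have "z\<^sup>2 \<le> A\<^sup>2" using assms(1) by (simp add: abs_le_square_iff[symmetric])
      then have "v * z\<^sup>2 \<le> v * A\<^sup>2" using assms(2) by (rule mult_left_mono)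
      then show ?thesis using True by (simp add: trunc_gauss_def indicator_def)
    next
      case False
      then have "z \<notin> {- A..A}" by auto
      then show ?thesis by (simp add: trunc_gauss_bounds[OF assms(2)])
    qed
  qed
  finally show ?thesis .
qed

lemma gauss_measure:
  assumes A: "0 < A" and v: "0 \<le> v"
  shows "real_distribution (gauss_measure A v)"
    and "cdf (gauss_measure A v) w = gauss_cdf A v w / (\<integral>z. trunc_gauss A v z \<partial>lborel)"
    and "AE z in gauss_measure A v. \<bar>z\<bar> \<le> A"
proof -
  define tot where "tot = (\<integral>z. trunc_gauss A v z \<partial>lborel)"
  have tot: "0 < tot" unfolding tot_def by (rule trunc_gauss_integral_pos[OF A v])
  have nn: "0 \<le> trunc_gauss A v z / tot" for z using trunc_gauss_bounds(1)[OF v] tot by simp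
  \<comment> \<open>The total mass is the instance \<open>UNIV\<close>, and the c.d.f. is the
    instance \<open>{..w}\<close>.\<close>
  have em: "emeasure (gauss_measure A v) S = ennreal ((\<integral>z. (if z \<in> S then trunc_gauss A v z else 0) \<partial>lborel) / tot)"
    if [measurable]: "S \<in> sets borel" for S
  proof -
    have "emeasure (gauss_measure A v) S = (\<integral>\<^sup>+z. ennreal (trunc_gauss A v z / tot) * indicator S z \<partial>lborel)"
      unfolding gauss_measure_def tot_def[symmetric] by (subst emeasure_density) measurable
    also have "\<dots> = (\<integral>\<^sup>+z. ennreal ((if z \<in> S then trunc_gauss A v z else 0) / tot) \<partial>lborel)"
      by (intro nn_integral_cong) (simp add: indicator_def)
    also have "\<dots> = ennreal (\<integral>z. (if z \<in> S then trunc_gauss A v z else 0) / tot \<partial>lborel)"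
    proof (rule nn_integral_eq_integral)
      show "integrable lborel (\<lambda>z. (if z \<in> S then trunc_gauss A v z else 0) / tot)"
        by (intro integrable_divide_zero integrable_trunc_gauss_restrict[OF v]) measurable
      show "AE z in lborel. 0 \<le> (if z \<in> S then trunc_gauss A v z else 0) / tot"
        using nn by (intro AE_I2) simp
    qed
    finally show ?thesis by simp
  qed
  have sets: "sets (gauss_measure A v) = sets borel" by (simp add: gauss_measure_def)
  show dist: "real_distribution (gauss_measure A v)"
  proof (intro real_distribution.intro real_distribution_axioms.intro prob_spaceI)
    show "emeasure (gauss_measure A v) (space (gauss_measure A v)) = 1"
      using em[of UNIV] tot by (simp add: gauss_measure_def tot_def[symmetric] space_density)
  qed (rule sets)
  interpret real_distribution "gauss_measure A v" by (rule dist)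
  have "0 \<le> gauss_cdf A v w / tot" using gauss_cdf_bounds(1)[OF v] tot by simp
  then show "cdf (gauss_measure A v) w = gauss_cdf A v w / (\<integral>z. trunc_gauss A v z \<partial>lborel)"
    using em[of "{..w}"] by (simp add: cdf_def measure_def gauss_cdf_def tot_def)
  show "AE z in gauss_measure A v. \<bar>z\<bar> \<le> A"
    unfolding gauss_measure_def by (subst AE_density) (simp_all add: trunc_gauss_def)
qed

lemma (in prob_space) prob_add_le_indep:
  assumes [measurable]: "X \<in> borel_measurable M" "Z \<in> borel_measurable M"
    and ind: "indep_var borel Z borel X"
  shows "prob {\<omega> \<in> space M. X \<omega> + Z \<omega> \<le> s} = expectation (\<lambda>\<omega>. cdf (distr M borel Z) (s - X \<omega>))"
proof -
  interpret Z: real_distribution "distr M borel Z" by simp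
  interpret X: real_distribution "distr M borel X" by simp
  have "emeasure M {\<omega> \<in> space M. X \<omega> + Z \<omega> \<le> s} = emeasure (distr M borel (\<lambda>\<omega>. Z \<omega> + X \<omega>)) {..s}"
    by (subst emeasure_distr) (auto intro!: arg_cong[where f = "emeasure M"] simp: add.commute)
  also have "distr M borel (\<lambda>\<omega>. Z \<omega> + X \<omega>) = convolution (distr M borel Z) (distr M borel X)"
    by (rule sum_indep_random_variable[OF ind]) measurable
  \<comment> \<open>The factors are exchanged because the convolution formula integrates over the
    first one, and the outer integral is to run over the law of \<open>X\<close>.\<close>
  also have "\<dots> = convolution (distr M borel X) (distr M borel Z)"
    by (rule convolution_commutative) (simp_all add: Z.finite_measure_axioms X.finite_measure_axioms)
  also have "emeasure \<dots> {..s} = (\<integral>\<^sup>+x. emeasure (distr M borel Z) {a. a + x \<in> {..s}} \<partial>distr M borel X)"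
    by (rule convolution_emeasure) (simp_all add: Z.finite_measure_axioms X.finite_measure_axioms)
  also have "\<dots> = (\<integral>\<^sup>+x. ennreal (cdf (distr M borel Z) (s - x)) \<partial>distr M borel X)"
  proof (rule nn_integral_cong)
    fix x
    have "{a. a + x \<in> {..s}} = {..s - x}" by (auto simp: algebra_simps)
    then show "emeasure (distr M borel Z) {a. a + x \<in> {..s}} = ennreal (cdf (distr M borel Z) (s - x))"
      by (simp add: cdf_def Z.emeasure_eq_measure)
  qed
  finally have eq: "emeasure M {\<omega> \<in> space M. X \<omega> + Z \<omega> \<le> s} =
    (\<integral>\<^sup>+x. ennreal (cdf (distr M borel Z) (s - x)) \<partial>distr M borel X)" .
  have [measurable]: "cdf (distr M borel Z) \<in> borel_measurable borel"
    by (intro borel_measurable_mono monoI Z.cdf_nondecreasing)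
  have "(\<integral>\<^sup>+x. ennreal (cdf (distr M borel Z) (s - x)) \<partial>distr M borel X) =
      (\<integral>\<^sup>+\<omega>. ennreal (cdf (distr M borel Z) (s - X \<omega>)) \<partial>M)"
    by (subst nn_integral_distr) simp_all
  also have "\<dots> = ennreal (expectation (\<lambda>\<omega>. cdf (distr M borel Z) (s - X \<omega>)))"
  proof (rule nn_integral_eq_integral)
    show "integrable M (\<lambda>\<omega>. cdf (distr M borel Z) (s - X \<omega>))"
      by (rule integrable_const_bound[of _ 1]) (simp_all add: Z.cdf_nonneg Z.cdf_bounded_prob)
  qed (simp add: Z.cdf_nonneg)
  finally show ?thesis
    using eq by (simp add: emeasure_eq_measure Z.cdf_nonneg integral_nonneg_AE)
qed

subsection \<open>The dominance theorem\<close>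

text \<open>Two reals fit strictly between the essential suprema; the upper one is still exceeded by
  \<open>X\<close> with positive probability. This turns an extended-real inequality into the form
  that the estimates use.\<close>

lemma (in prob_space) esssup_less_separate:
  assumes [measurable]: "X \<in> borel_measurable M" "Y \<in> borel_measurable M"
    and less: "esssup M (\<lambda>\<omega>. ereal (Y \<omega>)) < esssup M (\<lambda>\<omega>. ereal (X \<omega>))"
  obtains b c :: real where "AE \<omega> in M. Y \<omega> \<le> b" "b < c" "0 < prob {\<omega> \<in> space M. c \<le> X \<omega>}"
proof -
  obtain c where c: "esssup M (\<lambda>\<omega>. ereal (Y \<omega>)) < ereal c" "ereal c < esssup M (\<lambda>\<omega>. ereal (X \<omega>))"
    using ereal_dense2[OF less] by blast
  obtain b where b: "esssup M (\<lambda>\<omega>. ereal (Y \<omega>)) < ereal b" "ereal b < ereal c"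
    using ereal_dense2[OF c(1)] by blast
  show thesis
  proof (rule that)
    show "AE \<omega> in M. Y \<omega> \<le> b"
      using esssup_AE[of "\<lambda>\<omega>. ereal (Y \<omega>)" M]
    proof eventually_elim
      case (elim \<omega>)
      then have "ereal (Y \<omega>) < ereal b" using b(1) by (rule le_less_trans)
      then show ?case by simp
    qed
    show "b < c" using b(2) by simp
    have "0 < emeasure M {\<omega> \<in> space M. ereal c < ereal (X \<omega>)}"
      by (rule esssup_pos_measure[OF _ c(2)]) measurable
    also have "\<dots> \<le> emeasure M {\<omega> \<in> space M. c \<le> X \<omega>}"
      by (intro emeasure_mono) auto
    finally show "0 < prob {\<omega> \<in> space M. c \<le> X \<omega>}" by (simp add: emeasure_eq_measure)
  qed
qed

lemma K_simps:
  "K M (ereal 0) X = ereal (integral\<^sup>L M X)"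
  "r \<noteq> 0 \<Longrightarrow> K M (ereal r) X = ereal (1 / r * ln (integral\<^sup>L M (\<lambda>\<omega>. exp (r * X \<omega>))))"
  "K M \<infinity> X = esssup M (\<lambda>\<omega>. ereal (X \<omega>))"
  "K M (- \<infinity>) X = - esssup M (\<lambda>\<omega>. ereal (- X \<omega>))"
  unfolding K_def ess_max_def ess_min_def infinity_ereal_def uminus_ereal.simps ereal.case
  by simp_all

theorem theorem6:
  fixes M :: "'a measure" and X Y :: "'a \<Rightarrow> real"
  assumes "prob_space M" and "nonatomic M"
    and "X \<in> L_infty M" and "Y \<in> L_infty M"
    and "\<And>a :: ereal. K M a X > K M a Y"
  shows "\<exists>H :: real \<Rightarrow> real.
           (\<exists>W \<in> L_infty M. cdf (distr M borel W) = H) \<and>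
           (\<forall>X' \<in> L_infty M. \<forall>Y' \<in> L_infty M. \<forall>Z \<in> L_infty M.
              distr M borel X' = distr M borel X \<longrightarrow>
              distr M borel Y' = distr M borel Y \<longrightarrow>
              cdf (distr M borel Z) = H \<longrightarrow>
              prob_space.indep_var M borel Z borel X' \<longrightarrow>
              prob_space.indep_var M borel Z borel Y' \<longrightarrow>
              fosd M (\<lambda>\<omega>. X' \<omega> + Z \<omega>) (\<lambda>\<omega>. Y' \<omega> + Z \<omega>))"
proof -
  interpret prob_space M by (rule assms(1))
  have meas [measurable]: "X \<in> borel_measurable M" "Y \<in> borel_measurable M"
    using assms(3,4) by (simp_all add: L_infty_def)
  obtain c1 c2 where c12: "AE \<omega> in M. \<bar>X \<omega>\<bar> \<le> c1" "AE \<omega> in M. \<bar>Y \<omega>\<bar> \<le> c2"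
    using assms(3,4) unfolding L_infty_def by blast
  \<comment> \<open>The 1 makes \<open>N\<close> positive, as the bounds \<open>c1\<close> and
    \<open>c2\<close> may be 0.\<close>
  define N where "N = max 1 (max c1 c2)"
  have N: "0 < N" by (simp add: N_def)
  have bd: "AE \<omega> in M. \<bar>X \<omega>\<bar> \<le> N" "AE \<omega> in M. \<bar>Y \<omega>\<bar> \<le> N"
    by (rule eventually_mono[OF c12(1)], simp add: N_def) (rule eventually_mono[OF c12(2)], simp add: N_def)
  have mean: "expectation Y < expectation X"
    using assms(5)[of "ereal 0"] by (simp only: K_simps ereal_less_eq less_ereal.simps)
  \<comment> \<open>Positive moments are what allows \<open>ln\<close> to be removed from the
    inequalities between the \<open>K_a\<close>.\<close>
  have pos: "0 < expectation (\<lambda>\<omega>. exp (t * Z \<omega>))"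
    if "Z \<in> borel_measurable M" "AE \<omega> in M. \<bar>Z \<omega>\<bar> \<le> N" for t Z
  proof -
    have "exp (- (\<bar>t\<bar> * N)) \<le> expectation (\<lambda>\<omega>. exp (t * Z \<omega>))"
    proof (rule integral_ge_const[OF integrable_exp_bounded(1)[OF that]])
      show "AE \<omega> in M. exp (- (\<bar>t\<bar> * N)) \<le> exp (t * Z \<omega>)"
        using that(2)
      proof eventually_elim
        case (elim \<omega>)
        have "\<bar>t * Z \<omega>\<bar> \<le> \<bar>t\<bar> * N" unfolding abs_mult using elim by (intro mult_left_mono) simp_all
        then show ?case by simp
      qed
    qed
    then show ?thesis by (rule less_le_trans[OF exp_gt_zero])
  qed
  have exp_less: "1 / t * ln (expectation (\<lambda>\<omega>. exp (t * Y \<omega>))) < 1 / t * ln (expectation (\<lambda>\<omega>. exp (t * X \<omega>)))"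
    if "t \<noteq> 0" for t
    using assms(5)[of "ereal t"] unfolding K_simps(2)[OF that] by simp
  have exp_pos: "expectation (\<lambda>\<omega>. exp (t * Y \<omega>)) < expectation (\<lambda>\<omega>. exp (t * X \<omega>))" if "0 < t" for t
    using exp_less[of t] that pos[OF meas(1) bd(1)] pos[OF meas(2) bd(2)]
    by (simp add: divide_less_cancel)
  have exp_neg: "expectation (\<lambda>\<omega>. exp (t * X \<omega>)) < expectation (\<lambda>\<omega>. exp (t * Y \<omega>))" if "t < 0" for t
    using exp_less[of t] that pos[OF meas(1) bd(1)] pos[OF meas(2) bd(2)]
    by (simp add: divide_less_cancel)
  obtain b c where bc: "AE \<omega> in M. Y \<omega> \<le> b" "b < c" "0 < prob {\<omega> \<in> space M. c \<le> X \<omega>}"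
    using esssup_less_separate[OF meas] assms(5)[of \<infinity>] by (auto simp: K_simps)
  have "(\<lambda>\<omega>. - Y \<omega>) \<in> borel_measurable M" "(\<lambda>\<omega>. - X \<omega>) \<in> borel_measurable M" by measurable
  moreover have "esssup M (\<lambda>\<omega>. ereal (- X \<omega>)) < esssup M (\<lambda>\<omega>. ereal (- Y \<omega>))"
    using assms(5)[of "- \<infinity>"] unfolding K_simps ereal_minus_less_minus .
  ultimately obtain b' c' where bc': "AE \<omega> in M. - X \<omega> \<le> b'" "b' < c'"
      "0 < prob {\<omega> \<in> space M. c' \<le> - Y \<omega>}"
    by (rule esssup_less_separate)
  have dom: "right_dominance M X Y N b c"
    by unfold_locales (use meas N bd mean exp_pos exp_neg bc in simp_all)
  have dom': "right_dominance M (\<lambda>\<omega>. - Y \<omega>) (\<lambda>\<omega>. - X \<omega>) N b' c'"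
  proof unfold_locales
    fix t :: real
    show "expectation (\<lambda>\<omega>. exp (t * - X \<omega>)) < expectation (\<lambda>\<omega>. exp (t * - Y \<omega>))" if "0 < t"
      using exp_neg[of "- t"] that by simp
    show "expectation (\<lambda>\<omega>. exp (t * - Y \<omega>)) < expectation (\<lambda>\<omega>. exp (t * - X \<omega>))" if "t < 0"
      using exp_pos[of "- t"] that by simp
  qed (use meas N bd mean bc' in simp_all)
  obtain A v where Av: "0 < A" "0 < v"
    "\<And>s. expectation (\<lambda>\<omega>. gauss_cdf A v (s - X \<omega>)) \<le> expectation (\<lambda>\<omega>. gauss_cdf A v (s - Y \<omega>))"
    using gauss_dominance[OF dom dom'] by blast
  note gm = gauss_measure[OF Av(1) less_imp_le[OF Av(2)]]
  define tot where "tot = (\<integral>z. trunc_gauss A v z \<partial>lborel)"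
  have tot: "0 < tot" unfolding tot_def using Av by (intro trunc_gauss_integral_pos) simp_all
  \<comment> \<open>The witness that \<open>H\<close> is the c.d.f. of a bounded variable on this
    very space, obtained from nonatomicity.\<close>
  obtain W where W: "W \<in> borel_measurable M" "distr M borel W = gauss_measure A v"
    using nonatomic_imp_rv_with_distribution[OF assms(2) gm(1)] by blast
  have "AE \<omega> in M. \<bar>W \<omega>\<bar> \<le> A"
    using gm(3) unfolding W(2)[symmetric] by (rule AE_distrD[OF W(1)])
  then have "W \<in> L_infty M" using W(1) unfolding L_infty_def by blast
  moreover have "fosd M (\<lambda>\<omega>. X' \<omega> + Z \<omega>) (\<lambda>\<omega>. Y' \<omega> + Z \<omega>)"
    if in_L: "X' \<in> L_infty M" "Y' \<in> L_infty M" "Z \<in> L_infty M"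
      and d: "distr M borel X' = distr M borel X" "distr M borel Y' = distr M borel Y"
      and cdf: "cdf (distr M borel Z) = cdf (gauss_measure A v)"
      and ind: "indep_var borel Z borel X'" "indep_var borel Z borel Y'" for X' Y' Z
    unfolding fosd_def
  proof
    fix s
    have Z: "Z \<in> borel_measurable M" using in_L by (simp add: L_infty_def)
    \<comment> \<open>The probability depends on \<open>V'\<close> only through its law, so
      \<open>V'\<close> may be traded for \<open>V\<close>, for which the comparison is already
      available.\<close>
    have eq: "prob {\<omega> \<in> space M. V' \<omega> + Z \<omega> \<le> s} = expectation (\<lambda>\<omega>. gauss_cdf A v (s - V \<omega>)) / tot"
      if [measurable]: "V' \<in> borel_measurable M" "V \<in> borel_measurable M"
        and "distr M borel V' = distr M borel V" "indep_var borel Z borel V'" for V V'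
    proof -
      have "prob {\<omega> \<in> space M. V' \<omega> + Z \<omega> \<le> s} = expectation (\<lambda>\<omega>. gauss_cdf A v (s - V' \<omega>)) / tot"
        unfolding prob_add_le_indep[OF that(1) Z that(4)] cdf gm(2) tot_def by simp
      also have "expectation (\<lambda>\<omega>. gauss_cdf A v (s - V' \<omega>)) =
          (\<integral>x. gauss_cdf A v (s - x) \<partial>distr M borel V')"
        by (rule integral_distr[symmetric]) measurable
      also have "\<dots> = expectation (\<lambda>\<omega>. gauss_cdf A v (s - V \<omega>))"
        unfolding that(3) by (rule integral_distr) measurable
      finally show ?thesis .
    qed
    have "X' \<in> borel_measurable M" "Y' \<in> borel_measurable M" using in_L by (simp_all add: L_infty_def)
    then show "prob {\<omega> \<in> space M. X' \<omega> + Z \<omega> \<le> s} \<le> prob {\<omega> \<in> space M. Y' \<omega> + Z \<omega> \<le> s}"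
      using eq[OF _ meas(1) d(1) ind(1)] eq[OF _ meas(2) d(2) ind(2)] Av(3)[of s] tot
      by (simp add: divide_right_mono)
  qed
  ultimately show ?thesis
    using W(2) by (intro exI[of _ "cdf (gauss_measure A v)"] conjI ballI impI bexI[of _ W]) simp_all
qed

end
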